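(* Let $p\in[1,\infty]$ and let $E=\{E_a\}_{a=1}^{n_E}$ and $F=\{F_b\}_{b=1}^{n_F}$ be measurements on $\mathbb{C}^d$ such that $\Upsilon_p(E,F)=2^{\frac1p}\,d\sqrt{d-1}$. Then all the measurement operators of $E$ and $F$ are rank-1 and their overlaps are all equal to $\frac{1}{\sqrt d}$; that is, writing $E_a=\alpha_a|e_a\rangle\langle e_a|$ and $F_b=\beta_b|f_b\rangle\langle f_b|$ with unit vectors $|e_a\rangle,|f_b\rangle$ and $\alpha_a,\beta_b>0$, we have $|\langle e_a|f_b\rangle|=\frac1{\sqrt d}$ for all $a,b$.
   Context: A measurement with $n$ outcomes acting on $\mathbb{C}^d$ is a family $\{E_a\}_{a=1}^n$ of non-zero positive semi-definite operators on $\mathbb{C}^d$ with $\sum_a E_a=\mathbb{1}$. The Schatten $p$-norm $\|A\|_p$ is the $\ell_p$-norm of the vector of singular values of $A$ (the largest singular value for $p=\infty$). Define $\Upsilon_p(E,F):=\sum_{a=1}^{n_E}\sum_{b=1}^{n_F}\|[E_a,F_b]\|_p$, where $[A,B]=AB-BA$. Convention: $2^{1/p}=1$ for $p=\infty$. *)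

theory Defs
  imports
    "Jordan_Normal_Form.Schur_Decomposition"
    "Jordan_Normal_Form.Char_Poly"
    "Jordan_Normal_Form.DL_Rank"
    "HOL-Library.Extended_Real"
    "HOL-Computational_Algebra.Fundamental_Theorem_Algebra"
begin

(* In the order on type complex, "0 <= z" means that z is real and nonnegative.
   Over the complex numbers this condition on the quadratic form already forces
   A to be Hermitian. *)
definition pos_semidef :: "nat \<Rightarrow> complex mat \<Rightarrow> bool" where
  "pos_semidef d A \<longleftrightarrow>
     A \<in> carrier_mat d d \<and> (\<forall>v \<in> carrier_vec d. 0 \<le> (A *\<^sub>v v) \<bullet>c v)"

(* The outcomes are 1, ..., n; values of E outside {1..n} are irrelevant.
   The type of matrices has no additive-monoid instance, so the operator sum is
   written entrywise. *)
definition measurement :: "nat \<Rightarrow> nat \<Rightarrow> (nat \<Rightarrow> complex mat) \<Rightarrow> bool" where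
  "measurement d n E \<longleftrightarrow>
     (\<forall>a \<in> {1..n}. pos_semidef d (E a) \<and> E a \<noteq> 0\<^sub>m d d) \<and>
     mat d d (\<lambda>(i, j). \<Sum>a = 1..n. E a $$ (i, j)) = 1\<^sub>m d"

definition commutator :: "complex mat \<Rightarrow> complex mat \<Rightarrow> complex mat" where
  "commutator A B = A * B - B * A"

(* Square roots of the eigenvalues of A* A, counted with algebraic multiplicity.
   Those eigenvalues are real and nonnegative (see below), so Re loses nothing. *)
definition singular_values :: "complex mat \<Rightarrow> real multiset" where
  "singular_values A =
     image_mset (\<lambda>z. sqrt (Re z)) (proots (char_poly (mat_adjoint A * A)))"

lemma eigenvalues_adjoint_mult_nonneg:
  assumes A: "A \<in> carrier_mat n m"
    and z: "z \<in># proots (char_poly (mat_adjoint A * A))"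
  shows "(0::complex) \<le> z"
proof -
  have adj: "mat_adjoint A \<in> carrier_mat m n"
    using A unfolding mat_adjoint_def by auto
  have B: "mat_adjoint A * A \<in> carrier_mat m m"
    using adj A by auto
  have "char_poly (mat_adjoint A * A) \<noteq> 0"
    using degree_monic_char_poly[OF B] by auto
  then have "poly (char_poly (mat_adjoint A * A)) z = 0"
    using z by simp
  then have "eigenvalue (mat_adjoint A * A) z"
    using eigenvalue_root_char_poly[OF B] by blast
  then obtain v where v: "v \<in> carrier_vec m" "v \<noteq> 0\<^sub>v m"
    and ev: "(mat_adjoint A * A) *\<^sub>v v = z \<cdot>\<^sub>v v"
    using B unfolding eigenvalue_def eigenvector_def by auto
  define w where "w = A *\<^sub>v v"
  have w: "w \<in> carrier_vec n"
    using A v by (simp add: w_def)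
  have "z \<cdot>\<^sub>v v = mat_adjoint A *\<^sub>v w"
    using ev assoc_mult_mat_vec[OF adj A v(1)] by (simp add: w_def)
  then have eq: "z * (v \<bullet>c v) = (mat_adjoint A *\<^sub>v w) \<bullet>c v"
    using v(1) by (metis carrier_vec_conjugate smult_scalar_prod_distrib)
  have entry: "mat_adjoint A $$ (i, j) = conjugate (A $$ (j, i))" if "i < m" "j < n" for i j
    using A that unfolding mat_adjoint_def by (simp add: mat_of_rows_index)
  have "(mat_adjoint A *\<^sub>v w) \<bullet>c v
      = (\<Sum>i<m. (\<Sum>j<n. conjugate (A $$ (j, i)) * w $ j) * conjugate (v $ i))"
    using adj w v(1) entry
    by (auto simp: scalar_prod_def lessThan_atLeast0 intro!: sum.cong)
  also have "\<dots> = (\<Sum>j<n. w $ j * conjugate (\<Sum>i<m. A $$ (j, i) * v $ i))"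
    unfolding sum_distrib_right sum_distrib_left conjugate_complex_def cnj_sum
    by (subst sum.swap) (simp add: mult_ac)
  also have "\<dots> = w \<bullet>c w"
  proof -
    have "(A *\<^sub>v v) $ j = (\<Sum>i<m. A $$ (j, i) * v $ i)" if "j < n" for j
      using A v(1) that by (simp add: scalar_prod_def lessThan_atLeast0)
    then show ?thesis
      using w A by (auto simp: scalar_prod_def lessThan_atLeast0 w_def intro!: sum.cong)
  qed
  finally have "z * (v \<bullet>c v) = w \<bullet>c w"
    using eq by simp
  moreover have "0 \<le> w \<bullet>c w" by (rule conjugate_square_ge_0_vec)
  moreover have "0 < v \<bullet>c v"
    using v conjugate_square_greater_0_vec by blast
  ultimately show ?thesis
    by (auto simp: less_eq_complex_def less_complex_def complex_eq_iff)
      (metis mult_less_0_iff not_le)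
qed

lemma size_singular_values:
  assumes A: "A \<in> carrier_mat n m"
  shows "size (singular_values A) = m"
proof -
  have "mat_adjoint A * A \<in> carrier_mat m m"
    using A unfolding mat_adjoint_def by auto
  then show ?thesis
    using degree_monic_char_poly
    by (auto simp: singular_values_def size_proots_complex)
qed

definition schatten_norm :: "ereal \<Rightarrow> complex mat \<Rightarrow> real" where
  "schatten_norm p A =
     (if p = \<infinity> then Max (set_mset (singular_values A))
      else (\<Sum>s \<in># singular_values A. s powr real_of_ereal p) powr (1 / real_of_ereal p))"

definition Upsilon ::
  "ereal \<Rightarrow> nat \<Rightarrow> (nat \<Rightarrow> complex mat) \<Rightarrow> nat \<Rightarrow> (nat \<Rightarrow> complex mat) \<Rightarrow> real" where
  "Upsilon p nE E nF F =
     (\<Sum>a = 1..nE. \<Sum>b = 1..nF. schatten_norm p (commutator (E a) (F b)))"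

definition two_root :: "ereal \<Rightarrow> real" where
  "two_root p = (if p = \<infinity> then 1 else 2 powr (1 / real_of_ereal p))"

definition ketbra :: "complex vec \<Rightarrow> complex mat" where
  "ketbra v = mat (dim_vec v) (dim_vec v) (\<lambda>(i, j). v $ i * cnj (v $ j))"

definition rank_one_form ::
  "nat \<Rightarrow> nat \<Rightarrow> (nat \<Rightarrow> complex mat) \<Rightarrow> (nat \<Rightarrow> real) \<Rightarrow> (nat \<Rightarrow> complex vec) \<Rightarrow> bool" where
  "rank_one_form d n E \<alpha> e \<longleftrightarrow>
     (\<forall>a \<in> {1..n}. 0 < \<alpha> a \<and> e a \<in> carrier_vec d \<and> e a \<bullet>c e a = 1 \<and>
        E a = complex_of_real (\<alpha> a) \<cdot>\<^sub>m ketbra (e a))"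

end

(* For a positive semidefinite F <> 0 and a Hermitian E put
     S = sqrt (tr F * tr (E^2 F) - (tr (E F))^2).
   Then ||[E, F]||_p <= 2^(1/p) * S for every p in [1, oo]. For p = 1 write F = Y Y* and apply
   Cauchy-Schwarz to the diagonal of E F in an eigenbasis of i[E, F], after subtracting from E the
   optimal multiple of the identity. For p = oo note that the eigenvalues of i[E, F] add up to 0, so
   none exceeds half of the trace norm. The remaining p follow by interpolation.
   For two measurements, the sum of the numbers S over all pairs is bounded by d * sqrt (d - 1): use
   sqrt y <= y / (2c) + c / 2 with c = tr E_a * tr F_b * sqrt (d - 1) / d, the normalisations
   sum_b F_b = 1 and sum_a E_a = 1, and tr (E_a^2) <= (tr E_a)^2. Equality forces
   tr (E_a^2) = (tr E_a)^2, so that E_a has rank one, and tr (E_a F_b) = tr E_a * tr F_b / d, which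
   fixes the overlaps. Since Upsilon is symmetric, the F_b have rank one as well. *)
theory Submission
  imports Defs "HOL-Analysis.L2_Norm"
begin

subsection \<open>Diagonalization of Hermitian matrices\<close>

(* It would loop with assoc_mult_square_mat below, which associates to the left. *)
declare assoc_mult_mat [simp del]

lemma dim_mat_adjoint [simp]:
  "dim_row (mat_adjoint A) = dim_col A" "dim_col (mat_adjoint A) = dim_row A"
  by (auto simp: mat_adjoint_def)

lemma mat_adjoint_carrier [simp]: "A \<in> carrier_mat n m \<Longrightarrow> mat_adjoint A \<in> carrier_mat m n"
  by (intro carrier_matI) auto

lemma index_mat_adjoint [simp]:
  fixes A :: "complex mat"
  assumes "i < dim_col A" "j < dim_row A"
  shows "mat_adjoint A $$ (i, j) = cnj (A $$ (j, i))"
  using assms by (simp add: mat_adjoint_def mat_of_rows_index)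

lemma index_mult_mat_sum:
  assumes "A \<in> carrier_mat n m" "B \<in> carrier_mat m k" "i < n" "j < k"
  shows "(A * B) $$ (i, j) = (\<Sum>l<m. A $$ (i, l) * B $$ (l, j))"
  using assms by (auto simp: scalar_prod_def lessThan_atLeast0 intro!: sum.cong)

lemma mat_adjoint_adjoint [simp]: "mat_adjoint (mat_adjoint A) = (A :: complex mat)"
  by (rule eq_matI) auto

lemma mat_adjoint_mult:
  fixes A B :: "complex mat"
  assumes "A \<in> carrier_mat n m" "B \<in> carrier_mat m k"
  shows "mat_adjoint (A * B) = mat_adjoint B * mat_adjoint A"
proof (rule eq_matI)
  fix i j assume "i < dim_row (mat_adjoint B * mat_adjoint A)" "j < dim_col (mat_adjoint B * mat_adjoint A)"
  with assms have ij: "i < k" "j < n" by auto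
  show "mat_adjoint (A * B) $$ (i, j) = (mat_adjoint B * mat_adjoint A) $$ (i, j)"
    using assms ij index_mult_mat_sum[OF assms ij(2) ij(1)]
      index_mult_mat_sum[of "mat_adjoint B" k m "mat_adjoint A" n i j]
    by (simp add: mult.commute)
qed (use assms in auto)

lemma mult_carrier_square [simp]:
  "A \<in> carrier_mat d d \<Longrightarrow> B \<in> carrier_mat d d \<Longrightarrow> A * B \<in> carrier_mat d d"
  by simp

lemma assoc_mult_square_mat:
  assumes "A \<in> carrier_mat d d" "B \<in> carrier_mat d d" "C \<in> carrier_mat d d"
  shows "A * (B * C) = A * B * C"
  using assms by (simp add: assoc_mult_mat[of A d d B d C d])

lemma hermitian_conj:
  fixes A U :: "complex mat"
  assumes "A \<in> carrier_mat d d" "U \<in> carrier_mat d d" "mat_adjoint A = A"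
  shows "mat_adjoint (mat_adjoint U * A * U) = mat_adjoint U * A * U"
  using assms mat_adjoint_mult[of "mat_adjoint U * A" d d U d]
    mat_adjoint_mult[of "mat_adjoint U" d d A d] by (simp add: assoc_mult_square_mat[where d = d])

text \<open>Complete \<open>v\<close> to a basis, orthogonalise by Gram-Schmidt, which leaves the
  first vector unchanged, and normalise. The scalar \<open>c\<close> stays unspecified because only
  the direction of the first column matters when eigenvectors are split off one at a time.\<close>

lemma unitary_first_column:
  fixes v :: "complex vec"
  assumes v: "v \<in> carrier_vec n" "v \<noteq> 0\<^sub>v n"
  obtains U c where "U \<in> carrier_mat n n" "mat_adjoint U * U = 1\<^sub>m n" "col U 0 = c \<cdot>\<^sub>v v"
proof -
  have n: "n \<noteq> 0" using v by (auto intro: eq_vecI)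
  interpret cof_vec_space n "TYPE(complex)" .
  define b where "b = basis_completion v"
  note bc = basis_completion[OF v, folded b_def]
  from bc(6,7) n obtain vs where bv: "b = v # vs" by (cases b) auto
  define ws where "ws = gram_schmidt n b"
  from gram_schmidt_result[OF bc(2,4,5) refl, folded ws_def]
  have ws: "set ws \<subseteq> carrier_vec n" "corthogonal ws" "length ws = n"
    by (auto simp: bc(6))
  have hd: "ws ! 0 = v"
    using gram_schmidt_hd[OF v(1), of vs] ws(3) n hd_conv_nth[of ws]
    unfolding ws_def bv by (metis length_0_conv)
  have wsc: "ws ! i \<in> carrier_vec n" if "i < n" for i
    using ws that by auto
  \<comment> \<open>The factor that scales the \<open>i\<close>-th orthogonal vector to length one.
    The square of its length is a nonnegative real number, so taking \<open>Re\<close> changes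
    nothing.\<close>
  define s where "s i = complex_of_real (1 / sqrt (Re (ws ! i \<bullet>c ws ! i)))" for i
  define U where "U = mat n n (\<lambda>(i, j). ws ! j $ i * s j)"
  have U: "U \<in> carrier_mat n n" by (simp add: U_def)
  have "mat_adjoint U * U = 1\<^sub>m n"
  proof (rule eq_matI)
    fix i j assume "i < dim_row (1\<^sub>m n :: complex mat)" "j < dim_col (1\<^sub>m n :: complex mat)"
    then have ij: "i < n" "j < n" by auto
    have "(mat_adjoint U * U) $$ (i, j) = (\<Sum>l<n. mat_adjoint U $$ (i, l) * U $$ (l, j))"
      using U ij by (intro index_mult_mat_sum) auto
    also have "\<dots> = (\<Sum>l<n. (ws ! j $ l * cnj (ws ! i $ l)) * (s i * s j))"
      using U ij by (intro sum.cong) (auto simp: U_def s_def)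
    also have "\<dots> = (ws ! j \<bullet>c ws ! i) * (s i * s j)"
      using wsc[OF ij(1)] by (simp add: scalar_prod_def lessThan_atLeast0 sum_distrib_right)
    also have "\<dots> = 1\<^sub>m n $$ (i, j)"
    proof (cases "i = j")
      case True
      have "ws ! i \<bullet>c ws ! i \<noteq> 0" using corthogonalD[OF ws(2), of i i] ij ws by auto
      moreover have "0 \<le> ws ! i \<bullet>c ws ! i" by (rule conjugate_square_ge_0_vec)
      ultimately obtain r where r: "ws ! i \<bullet>c ws ! i = complex_of_real r" "r > 0"
        using that[of "Re (ws ! i \<bullet>c ws ! i)"]
        by (auto simp: less_eq_complex_def complex_eq_iff)
      show ?thesis using True ij r by (simp add: s_def flip: of_real_mult)
    next
      case False
      have "ws ! j \<bullet>c ws ! i = 0" using corthogonalD[OF ws(2), of j i] ij ws False by auto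
      then show ?thesis using False ij by simp
    qed
    finally show "(mat_adjoint U * U) $$ (i, j) = 1\<^sub>m n $$ (i, j)" .
  qed (use U in auto)
  moreover have "col U 0 = s 0 \<cdot>\<^sub>v v"
    using v n hd by (intro eq_vecI) (auto simp: U_def)
  ultimately show ?thesis using that U by blast
qed

text \<open>Deflation: with an eigenvector as the first column of a unitary \<open>U\<close>, the
  matrix \<open>mat_adjoint U * A * U\<close> splits into a 1 x 1 block and a Hermitian block of
  size \<open>n\<close>, to which the induction hypothesis applies.\<close>

theorem hermitian_diagonalization:
  fixes A :: "complex mat"
  assumes "A \<in> carrier_mat d d" "mat_adjoint A = A"
  shows "\<exists>U \<mu>. U \<in> carrier_mat d d \<and> mat_adjoint U * U = 1\<^sub>m d \<and>
    A = U * mat_diag d (\<lambda>i. complex_of_real (\<mu> i)) * mat_adjoint U"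
  using assms
proof (induction d arbitrary: A)
  case 0
  show ?case
    by (rule exI[of _ "1\<^sub>m 0"], rule exI[of _ "\<lambda>_. 0"]) (use 0 in \<open>auto intro!: eq_matI\<close>)
next
  case (Suc n A)
  note A = Suc.prems(1) and herm = Suc.prems(2)
  have "degree (char_poly A) = Suc n" using degree_monic_char_poly[OF A] by auto
  then obtain e where "poly (char_poly A) e = 0"
    using fundamental_theorem_of_algebra[of "char_poly A"] by (auto simp: constant_degree)
  then obtain v where v: "v \<in> carrier_vec (Suc n)" "v \<noteq> 0\<^sub>v (Suc n)" and ev: "A *\<^sub>v v = e \<cdot>\<^sub>v v"
    using eigenvalue_root_char_poly[OF A] A unfolding eigenvalue_def eigenvector_def by auto
  from unitary_first_column[OF v] obtain U c where
    U: "U \<in> carrier_mat (Suc n) (Suc n)" and UU: "mat_adjoint U * U = 1\<^sub>m (Suc n)"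
    and cU: "col U 0 = c \<cdot>\<^sub>v v" by blast
  have UU': "U * mat_adjoint U = 1\<^sub>m (Suc n)"
    using mat_mult_left_right_inverse[of "mat_adjoint U" "Suc n" U] U UU by auto
  define B where "B = mat_adjoint U * A * U"
  have B: "B \<in> carrier_mat (Suc n) (Suc n)" using U A by (simp add: B_def)
  have Bh: "mat_adjoint B = B" unfolding B_def by (rule hermitian_conj[OF A U herm])
  have Bc: "cnj (B $$ (j, i)) = B $$ (i, j)" if "i < Suc n" "j < Suc n" for i j
    using arg_cong[OF Bh, of "\<lambda>M. M $$ (i, j)"] B that by simp
  \<comment> \<open>The first column of \<open>U\<close> is an eigenvector of \<open>A\<close>, and
    \<open>mat_adjoint U\<close> sends that column to the first unit vector; so the first column of
    \<open>B\<close> is \<open>e\<close> times this unit vector.\<close>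
  have "col B 0 = col (mat_adjoint U * (A * U)) 0"
    unfolding B_def using A U by (simp only: assoc_mult_square_mat[where d = "Suc n"] mat_adjoint_carrier)
  also have "\<dots> = mat_adjoint U *\<^sub>v col (A * U) 0"
    using A U by (intro col_mult2[of _ "Suc n" "Suc n" _ "Suc n"]) auto
  also have "col (A * U) 0 = A *\<^sub>v col U 0"
    using A U by (intro col_mult2[of _ "Suc n" "Suc n" _ "Suc n"]) auto
  also have "A *\<^sub>v col U 0 = e \<cdot>\<^sub>v col U 0"
    unfolding cU using A v ev by (simp add: mult_mat_vec[OF A] smult_smult_assoc mult.commute)
  also have "mat_adjoint U *\<^sub>v (e \<cdot>\<^sub>v col U 0) = e \<cdot>\<^sub>v col (mat_adjoint U * U) 0"
    using U mult_mat_vec[of "mat_adjoint U" "Suc n" "Suc n" "col U 0" e]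
    by (simp add: col_mult2[of _ "Suc n" "Suc n" _ "Suc n"] carrier_vecI)
  also have "col (mat_adjoint U * U) 0 = unit_vec (Suc n) 0"
    unfolding UU by simp
  finally have "col B 0 = e \<cdot>\<^sub>v unit_vec (Suc n) 0" .
  then have B0: "B $$ (i, 0) = (if i = 0 then e else 0)" if "i < Suc n" for i
    using B that by (metis carrier_matD index_col index_smult_vec(1) index_unit_vec(1) index_unit_vec(3)
        mult.right_neutral mult_zero_right zero_less_Suc)
  \<comment> \<open>Since \<open>B\<close> is Hermitian, its first row vanishes off the diagonal as
    well, and the corner entry \<open>e\<close> equals its own conjugate, hence is real.\<close>
  have B0': "B $$ (0, i) = (if i = 0 then e else 0)" if "i < Suc n" for i
    using B0[OF that] Bc[of 0 i] Bc[of 0 0] B0[of 0] that by (auto split: if_splits)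
  have re: "complex_of_real (Re e) = e"
    using Bc[of 0 0] B0[of 0] by (simp add: complex_eq_iff)
  define C where "C = mat n n (\<lambda>(i, j). B $$ (Suc i, Suc j))"
  have C: "C \<in> carrier_mat n n" by (simp add: C_def)
  have "mat_adjoint C = C"
    by (rule eq_matI) (auto simp: C_def Bc)
  from Suc.IH[OF C this] obtain V \<mu> where V: "V \<in> carrier_mat n n" and VV: "mat_adjoint V * V = 1\<^sub>m n"
    and CV: "C = V * mat_diag n (\<lambda>i. complex_of_real (\<mu> i)) * mat_adjoint V" by blast
  let ?D = "mat_diag n (\<lambda>i. complex_of_real (\<mu> i))"
  let ?E = "mat 1 1 (\<lambda>_. e)"
  \<comment> \<open>Extend the diagonalizing matrix \<open>V\<close> of the small block by a 1 in
    the corner; \<open>U * W\<close> then diagonalizes \<open>A\<close>, with eigenvalues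
    \<open>Re e\<close> followed by those of the block.\<close>
  define W where "W = four_block_mat (1\<^sub>m 1) (0\<^sub>m 1 n) (0\<^sub>m n 1) V"
  define \<nu> where "\<nu> i = (case i of 0 \<Rightarrow> Re e | Suc j \<Rightarrow> \<mu> j)" for i
  let ?N = "mat_diag (Suc n) (\<lambda>i. complex_of_real (\<nu> i))"
  have W: "W \<in> carrier_mat (Suc n) (Suc n)"
    using V four_block_carrier_mat[of "1\<^sub>m 1" 1 1 V n n] by (simp add: W_def)
  have aW: "mat_adjoint W = four_block_mat (1\<^sub>m 1) (0\<^sub>m 1 n) (0\<^sub>m n 1) (mat_adjoint V)"
    using V by (intro eq_matI) (auto simp: W_def)
  have WW: "mat_adjoint W * W = 1\<^sub>m (Suc n)"
    unfolding aW unfolding W_def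
    by (subst mult_four_block_mat[of _ 1 1 _ n _ n]) (use V VV in auto)
  have N: "?N = four_block_mat ?E (0\<^sub>m 1 n) (0\<^sub>m n 1) ?D"
    by (rule eq_matI) (auto simp: mat_diag_def \<nu>_def re split: nat.split)
  have Z: "0\<^sub>m 1 n * ?D = 0\<^sub>m 1 n" "V * 0\<^sub>m n 1 = 0\<^sub>m n 1"
    using V by (auto intro!: left_mult_zero_mat[of _ n n] right_mult_zero_mat[of _ n n])
  have WN: "W * ?N = four_block_mat ?E (0\<^sub>m 1 n) (0\<^sub>m n 1) (V * ?D)"
    unfolding N W_def
    by (subst mult_four_block_mat[of _ 1 1 _ n _ n], use V Z in auto)
  have "B = four_block_mat ?E (0\<^sub>m 1 n) (0\<^sub>m n 1) C"
    by (rule eq_matI) (use B in \<open>auto simp: C_def B0 B0'\<close>)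
  also have "\<dots> = W * ?N * mat_adjoint W"
    unfolding aW WN CV
    by (subst mult_four_block_mat[of _ 1 1 _ n _ n])
       (use V in \<open>auto simp: left_mult_zero_mat right_mult_zero_mat[of _ n n] right_mult_zero_mat[of _ 1 1]\<close>)
  finally have BW: "B = W * ?N * mat_adjoint W" .
  have "A = (U * mat_adjoint U) * A * (U * mat_adjoint U)" using A UU' by simp
  also have "\<dots> = U * B * mat_adjoint U"
    unfolding B_def using A U by (simp add: assoc_mult_square_mat[where d = "Suc n"])
  also have "\<dots> = (U * W) * ?N * mat_adjoint (U * W)"
    unfolding BW using U W by (simp add: assoc_mult_square_mat[where d = "Suc n"] mat_adjoint_mult[OF U W])
  finally have "A = (U * W) * ?N * mat_adjoint (U * W)" .
  moreover have "mat_adjoint (U * W) * (U * W) = 1\<^sub>m (Suc n)"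
  proof -
    have "mat_adjoint (U * W) * (U * W) = mat_adjoint W * (mat_adjoint U * U) * W"
      using U W by (simp add: assoc_mult_square_mat[where d = "Suc n"] mat_adjoint_mult[OF U W])
    then show ?thesis using U W UU WW by simp
  qed
  ultimately show ?case using U W by (intro exI[of _ "U * W"] exI[of _ \<nu>]) auto
qed

subsection \<open>Traces and positive semidefinite matrices\<close>

definition mat_trace :: "complex mat \<Rightarrow> complex" where
  "mat_trace A = (\<Sum>i<dim_row A. A $$ (i, i))"

lemma mat_trace_mult:
  assumes "A \<in> carrier_mat n m" "B \<in> carrier_mat m n"
  shows "mat_trace (A * B) = (\<Sum>i<n. \<Sum>j<m. A $$ (i, j) * B $$ (j, i))"
  using assms by (auto simp: mat_trace_def intro!: sum.cong index_mult_mat_sum simp del: index_mult_mat(1))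

lemma mat_trace_comm:
  assumes "A \<in> carrier_mat n m" "B \<in> carrier_mat m n"
  shows "mat_trace (A * B) = mat_trace (B * A)"
  unfolding mat_trace_mult[OF assms] mat_trace_mult[OF assms(2,1)]
  by (subst sum.swap) (simp add: mult.commute)

lemma mat_trace_minus:
  assumes "A \<in> carrier_mat d d" "B \<in> carrier_mat d d"
  shows "mat_trace (A - B) = mat_trace A - mat_trace B"
  using assms by (auto simp: mat_trace_def sum_subtractf)

lemma mat_trace_smult:
  assumes "A \<in> carrier_mat d d"
  shows "mat_trace (c \<cdot>\<^sub>m A) = c * mat_trace A"
  using assms by (auto simp: mat_trace_def sum_distrib_left)

lemma mat_trace_conj:
  assumes "A \<in> carrier_mat d d" "U \<in> carrier_mat d d" "V \<in> carrier_mat d d" "U * V = 1\<^sub>m d"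
  shows "mat_trace (V * A * U) = mat_trace A"
proof -
  have "mat_trace (V * A * U) = mat_trace (U * (V * A))"
    using assms by (intro mat_trace_comm[of _ d d]) auto
  also have "U * (V * A) = A" using assms by (simp add: assoc_mult_square_mat[where d = d])
  finally show ?thesis .
qed

lemma mat_trace_adjoint_square:
  assumes "A \<in> carrier_mat n m"
  shows "mat_trace (A * mat_adjoint A) = complex_of_real (\<Sum>i<n. \<Sum>j<m. (cmod (A $$ (i, j)))\<^sup>2)"
  using assms
  by (subst mat_trace_mult[of _ n m]) (auto intro!: sum.cong simp: complex_norm_square simp del: of_real_power)

lemma unitary_commute:
  assumes "U \<in> carrier_mat d d" "mat_adjoint U * U = 1\<^sub>m d"
  shows "U * mat_adjoint U = (1\<^sub>m d :: complex mat)"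
  using mat_mult_left_right_inverse[of "mat_adjoint U" d U] assms by auto

lemma unitary_conj_cancel:
  fixes U D :: "complex mat"
  assumes "U \<in> carrier_mat d d" "mat_adjoint U * U = 1\<^sub>m d" "D \<in> carrier_mat d d"
  shows "mat_adjoint U * (U * D * mat_adjoint U) * U = D"
proof -
  have "mat_adjoint U * (U * D * mat_adjoint U) * U = (mat_adjoint U * U) * D * (mat_adjoint U * U)"
    using assms(1,3) by (simp add: assoc_mult_square_mat[where d = d])
  then show ?thesis
    using assms left_mult_one_mat[of D d d] right_mult_one_mat[of D d d] by simp
qed

section \<open>Positive semidefinite matrices: spectrum, factorization, trace\<close>

lemma pos_semidef_carrier: "pos_semidef d A \<Longrightarrow> A \<in> carrier_mat d d"
  by (simp add: pos_semidef_def)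

lemma quadratic_form_sum:
  assumes "A \<in> carrier_mat d d" "v \<in> carrier_vec d"
  shows "(A *\<^sub>v v) \<bullet>c v = (\<Sum>i<d. \<Sum>j<d. cnj (v $ i) * A $$ (i, j) * v $ j)"
proof -
  have "(A *\<^sub>v v) \<bullet>c v = (\<Sum>i<d. (A *\<^sub>v v) $ i * cnj (v $ i))"
    using assms by (auto simp: scalar_prod_def lessThan_atLeast0)
  also have "\<dots> = (\<Sum>i<d. (\<Sum>j<d. A $$ (i, j) * v $ j) * cnj (v $ i))"
    using assms by (intro sum.cong) (auto simp: scalar_prod_def lessThan_atLeast0)
  finally show ?thesis by (simp add: sum_distrib_right sum_distrib_left mult_ac)
qed

text \<open>Polarization: a quadratic form that is real at the unit vectors, at sums of two of them,
  and at such sums with one summand multiplied by the imaginary unit determines conjugate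
  off-diagonal entries.\<close>

lemma pos_semidef_hermitian:
  assumes "pos_semidef d A"
  shows "mat_adjoint A = A"
proof (rule eq_matI)
  have A: "A \<in> carrier_mat d d" and q: "\<And>v. v \<in> carrier_vec d \<Longrightarrow> 0 \<le> (A *\<^sub>v v) \<bullet>c v"
    using assms by (auto simp: pos_semidef_def)
  have im: "Im (\<Sum>i<d. \<Sum>j<d. cnj (f i) * A $$ (i, j) * f j) = 0" for f
    using q[of "vec d f"] quadratic_form_sum[OF A, of "vec d f"] by (simp add: less_eq_complex_def)
  fix i j assume "i < dim_row A" "j < dim_col A"
  then have ij: "i < d" "j < d" using A by auto
  \<comment> \<open>At a vector supported on the coordinates \<open>i\<close> and \<open>j\<close>
    only four terms of the quadratic form survive.\<close>
  have two: "(\<Sum>k<d. \<Sum>l<d. cnj (f k) * A $$ (k, l) * f l) =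
      cnj (f i) * A $$ (i, i) * f i + cnj (f i) * A $$ (i, j) * f j +
      cnj (f j) * A $$ (j, i) * f i + cnj (f j) * A $$ (j, j) * f j"
    if "i \<noteq> j" "\<And>k. k \<noteq> i \<Longrightarrow> k \<noteq> j \<Longrightarrow> f k = 0" for f
  proof -
    have red: "(\<Sum>k<d. g k) = g i + g j" if "\<And>k. k \<noteq> i \<Longrightarrow> k \<noteq> j \<Longrightarrow> g k = 0" for g :: "nat \<Rightarrow> complex"
    proof -
      have "(\<Sum>k<d. g k) = (\<Sum>k\<in>{i, j}. g k)"
        using ij that by (intro sum.mono_neutral_right) auto
      then show ?thesis using \<open>i \<noteq> j\<close> by simp
    qed
    let ?h = "\<lambda>k l. cnj (f k) * A $$ (k, l) * f l"
    have "(\<Sum>k<d. \<Sum>l<d. ?h k l) = (\<Sum>l<d. ?h i l) + (\<Sum>l<d. ?h j l)"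
      by (rule red) (simp add: that(2))
    also have "(\<Sum>l<d. ?h i l) = ?h i i + ?h i j" by (rule red) (simp add: that(2))
    also have "(\<Sum>l<d. ?h j l) = ?h j i + ?h j j" by (rule red) (simp add: that(2))
    finally show ?thesis by (simp only: add.assoc)
  qed
  have diag: "Im (A $$ (k, k)) = 0" if "k < d" for k
  proof -
    let ?f = "\<lambda>l. if l = k then 1 else 0 :: complex"
    have "(\<Sum>i<d. \<Sum>j<d. cnj (?f i) * A $$ (i, j) * ?f j) =
        (\<Sum>i<d. \<Sum>j<d. if j = k then if i = k then A $$ (k, k) else 0 else 0)"
      by (intro sum.cong) auto
    also have "\<dots> = A $$ (k, k)" using that by simp
    finally show ?thesis using im[of ?f] by simp
  qed
  have "A $$ (i, j) = cnj (A $$ (j, i))"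
  proof (cases "i = j")
    case True
    then show ?thesis using diag[OF ij(1)] by (simp add: complex_eq_iff)
  next
    case False
    \<comment> \<open>With real diagonal entries, \<open>f\<close> shows that the imaginary parts of
      the entries at (i, j) and (j, i) cancel, and \<open>g\<close> shows that their real parts
      agree.\<close>
    define f g :: "nat \<Rightarrow> complex" where
      "f k = (if k = i then 1 else if k = j then 1 else 0)" and
      "g k = (if k = i then 1 else if k = j then \<i> else 0)" for k
    have v: "f i = 1" "f j = 1" "g i = 1" "g j = \<i>" using False by (auto simp: f_def g_def)
    have z: "f k = 0" "g k = 0" if "k \<noteq> i" "k \<noteq> j" for k using that by (auto simp: f_def g_def)
    have tf: "(\<Sum>k<d. \<Sum>l<d. cnj (f k) * A $$ (k, l) * f l) = A $$ (i, i) + A $$ (i, j) + A $$ (j, i) + A $$ (j, j)"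
      using two[OF False, of f] z(1) v by simp
    have tg: "(\<Sum>k<d. \<Sum>l<d. cnj (g k) * A $$ (k, l) * g l) = A $$ (i, i) + A $$ (i, j) * \<i> - \<i> * A $$ (j, i) - \<i> * A $$ (j, j) * \<i>"
      using two[OF False, of g] z(2) v by simp
    have "Im (A $$ (i, j) + A $$ (j, i)) = 0"
      using im[of f, unfolded tf] diag[OF ij(1)] diag[OF ij(2)] by (simp add: v)
    moreover have "Re (A $$ (i, j)) - Re (A $$ (j, i)) = 0"
      using im[of g, unfolded tg] diag[OF ij(1)] diag[OF ij(2)] by (simp add: v)
    ultimately show ?thesis by (simp add: complex_eq_iff)
  qed
  then show "mat_adjoint A $$ (i, j) = A $$ (i, j)" using A ij by simp
qed (use pos_semidef_carrier[OF assms] in auto)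

text \<open>Each eigenvalue \<open>\<mu> k\<close> is the value of the quadratic form at the
  \<open>k\<close>-th column of \<open>U\<close>, hence nonnegative.\<close>

lemma pos_semidef_diagonalization:
  assumes "pos_semidef d A"
  obtains U \<mu> where "U \<in> carrier_mat d d" "mat_adjoint U * U = 1\<^sub>m d"
    "A = U * mat_diag d (\<lambda>i. complex_of_real (\<mu> i)) * mat_adjoint U" "\<And>i. i < d \<Longrightarrow> 0 \<le> \<mu> i"
proof -
  have A: "A \<in> carrier_mat d d" by (rule pos_semidef_carrier[OF assms])
  let ?D = "\<lambda>\<mu>. mat_diag d (\<lambda>i. complex_of_real (\<mu> i))"
  from hermitian_diagonalization[OF A pos_semidef_hermitian[OF assms]] obtain U \<mu>
    where U: "U \<in> carrier_mat d d" "mat_adjoint U * U = 1\<^sub>m d" and AU: "A = U * ?D \<mu> * mat_adjoint U"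
    by blast
  have "0 \<le> \<mu> k" if k: "k < d" for k
  proof -
    have ck: "col U k \<in> carrier_vec d" using U(1) by (auto intro: carrier_vecI)
    have "mat_adjoint U * A * U = ?D \<mu>"
      unfolding AU by (rule unitary_conj_cancel[OF U]) simp
    then have "mat_adjoint U * (A * U) = ?D \<mu>"
      using U(1) A by (simp only: assoc_mult_square_mat[where d = d] mat_adjoint_carrier)
    then have "complex_of_real (\<mu> k) = (mat_adjoint U * (A * U)) $$ (k, k)"
      using k by (simp only: mat_diag_def) simp
    also have "\<dots> = (\<Sum>i<d. mat_adjoint U $$ (k, i) * (A * U) $$ (i, k))"
      by (rule index_mult_mat_sum) (use U A k in auto)
    also have "\<dots> = (\<Sum>i<d. mat_adjoint U $$ (k, i) * (\<Sum>j<d. A $$ (i, j) * U $$ (j, k)))"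
      by (intro sum.cong refl arg_cong2[of _ _ _ _ "(*)"] index_mult_mat_sum) (use U A k in auto)
    also have "\<dots> = (\<Sum>i<d. \<Sum>j<d. cnj (U $$ (i, k)) * A $$ (i, j) * U $$ (j, k))"
      using U k by (auto simp: sum_distrib_left mult.assoc intro!: sum.cong)
    also have "\<dots> = (A *\<^sub>v col U k) \<bullet>c col U k"
      unfolding quadratic_form_sum[OF A ck] using U k by simp
    finally have "complex_of_real (\<mu> k) = (A *\<^sub>v col U k) \<bullet>c col U k" .
    moreover have "0 \<le> (A *\<^sub>v col U k) \<bullet>c col U k"
      using assms ck unfolding pos_semidef_def by blast
    ultimately have "0 \<le> complex_of_real (\<mu> k)" by (simp only:)
    then show ?thesis by (simp add: less_eq_complex_def)
  qed
  with U AU that show ?thesis by blast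
qed

text \<open>Take \<open>Y = U * S\<close>, where \<open>S\<close> is the diagonal matrix of square
  roots of the eigenvalues.\<close>

lemma pos_semidef_factor:
  assumes "pos_semidef d A"
  obtains Y where "Y \<in> carrier_mat d d" "A = Y * mat_adjoint Y"
proof -
  from pos_semidef_diagonalization[OF assms] obtain U \<mu> where
    U: "U \<in> carrier_mat d d" "mat_adjoint U * U = 1\<^sub>m d"
    and AU: "A = U * mat_diag d (\<lambda>i. complex_of_real (\<mu> i)) * mat_adjoint U"
    and \<mu>: "\<And>i. i < d \<Longrightarrow> 0 \<le> \<mu> i" by blast
  define S where "S = mat_diag d (\<lambda>i. complex_of_real (sqrt (\<mu> i)))"
  have S: "S \<in> carrier_mat d d" "mat_adjoint S = S"
    by (auto simp: S_def mat_diag_def intro!: eq_matI)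
  have "mat_diag d (\<lambda>i. complex_of_real (\<mu> i)) = S * S"
    unfolding S_def mat_diag_diag by (rule eq_matI) (auto simp: mat_diag_def \<mu> simp flip: of_real_mult)
  then have "A = (U * S) * mat_adjoint (U * S)"
    unfolding AU using U S by (simp add: mat_adjoint_mult[of U d d S d] assoc_mult_square_mat[where d = d])
  then show ?thesis using that[of "U * S"] U S by auto
qed

text \<open>For \<open>A = Y * mat_adjoint Y\<close> the trace is the sum of the squared moduli of
  the entries of \<open>Y\<close>; if it is not positive, then \<open>Y\<close>, and with it
  \<open>A\<close>, is zero.\<close>

lemma pos_semidef_trace_pos:
  assumes "pos_semidef d A" "A \<noteq> 0\<^sub>m d d"
  shows "0 < Re (mat_trace A)"
proof (rule ccontr)
  assume "\<not> 0 < Re (mat_trace A)"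
  obtain Y where Y: "Y \<in> carrier_mat d d" and A: "A = Y * mat_adjoint Y"
    using pos_semidef_factor[OF assms(1)] .
  have "(\<Sum>i<d. \<Sum>j<d. (cmod (Y $$ (i, j)))\<^sup>2) \<le> 0"
    using \<open>\<not> 0 < Re (mat_trace A)\<close> unfolding A mat_trace_adjoint_square[OF Y] by simp
  then have "(\<Sum>i<d. \<Sum>j<d. (cmod (Y $$ (i, j)))\<^sup>2) = 0"
    by (intro antisym sum_nonneg) auto
  then have "Y $$ (i, j) = 0" if "i < d" "j < d" for i j
    using that by (simp add: sum_nonneg_eq_0_iff sum_nonneg)
  then have "Y = 0\<^sub>m d d" using Y by (intro eq_matI) auto
  with A assms(2) show False using left_mult_zero_mat[of "mat_adjoint Y" d d d] by auto
qed

subsection \<open>Singular values of a commutator\<close>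

text \<open>A diagonal entry of \<open>E * F\<close> is an inner product of a row of
  \<open>X = E * Y\<close> with the same row of \<open>Y\<close>. A single Cauchy-Schwarz over all
  index pairs then bounds the sum by the Frobenius norms of \<open>X\<close> and \<open>Y\<close>,
  whose squares are the two traces.\<close>

lemma sum_cmod_diag_mult_le:
  fixes E Y :: "complex mat"
  assumes E: "E \<in> carrier_mat d d" and Y: "Y \<in> carrier_mat d d"
  defines "F \<equiv> Y * mat_adjoint Y"
  shows "(\<Sum>k<d. cmod ((E * F) $$ (k, k))) \<le>
    sqrt (Re (mat_trace (E * F * mat_adjoint E)) * Re (mat_trace F))"
proof -
  define X where "X = E * Y"
  have X: "X \<in> carrier_mat d d" using E Y by (simp add: X_def)
  have EF: "E * F = X * mat_adjoint Y" and EFE: "E * F * mat_adjoint E = X * mat_adjoint X"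
    using E Y by (simp_all add: F_def X_def assoc_mult_square_mat[where d = d] mat_adjoint_mult[of E d d Y d])
  let ?I = "{..<d} \<times> {..<d}"
  have "(\<Sum>k<d. cmod ((E * F) $$ (k, k))) \<le> (\<Sum>k<d. \<Sum>j<d. \<bar>cmod (X $$ (k, j))\<bar> * \<bar>cmod (Y $$ (k, j))\<bar>)"
  proof (rule sum_mono)
    fix k assume "k \<in> {..<d}"
    then have "(E * F) $$ (k, k) = (\<Sum>j<d. X $$ (k, j) * mat_adjoint Y $$ (j, k))"
      unfolding EF using X Y by (intro index_mult_mat_sum) auto
    also have "\<dots> = (\<Sum>j<d. X $$ (k, j) * cnj (Y $$ (k, j)))"
      using Y \<open>k \<in> _\<close> by (intro sum.cong) auto
    finally show "cmod ((E * F) $$ (k, k)) \<le> (\<Sum>j<d. \<bar>cmod (X $$ (k, j))\<bar> * \<bar>cmod (Y $$ (k, j))\<bar>)"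
      by (auto intro!: sum_norm_le simp: norm_mult)
  qed
  also have "\<dots> = (\<Sum>z\<in>?I. \<bar>cmod (X $$ z)\<bar> * \<bar>cmod (Y $$ z)\<bar>)"
    by (simp add: sum.cartesian_product)
  also have "\<dots> \<le> L2_set (\<lambda>z. cmod (X $$ z)) ?I * L2_set (\<lambda>z. cmod (Y $$ z)) ?I"
    by (rule L2_set_mult_ineq)
  also have "\<dots> = sqrt (Re (mat_trace (E * F * mat_adjoint E)) * Re (mat_trace F))"
    using mat_trace_adjoint_square[OF X] mat_trace_adjoint_square[OF Y]
    by (simp add: L2_set_def sum.cartesian_product real_sqrt_mult EFE F_def[symmetric])
  finally show ?thesis .
qed

text \<open>Similar matrices share their characteristic polynomial, so its roots are the numbers
  \<open>(\<mu> i)\<^sup>2\<close> with multiplicity, and their square roots are the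
  \<open>\<bar>\<mu> i\<bar>\<close>.\<close>

lemma singular_values_of_gram_diag:
  assumes U: "U \<in> carrier_mat d d" "mat_adjoint U * U = 1\<^sub>m d"
    and K: "K \<in> carrier_mat d d"
    and KK: "mat_adjoint K * K = U * mat_diag d (\<lambda>i. complex_of_real ((\<mu> i)\<^sup>2)) * mat_adjoint U"
  shows "singular_values K = image_mset (\<lambda>i. \<bar>\<mu> i\<bar>) (mset_set {..<d})"
proof -
  let ?D = "mat_diag d (\<lambda>i. complex_of_real ((\<mu> i)\<^sup>2))"
  have "similar_mat_wit (mat_adjoint K * K) ?D U (mat_adjoint U)"
    using U unitary_commute[OF U] K KK
    by (intro similar_mat_witI[of _ _ d]) auto
  then have "char_poly (mat_adjoint K * K) = char_poly ?D"
    by (intro char_poly_similar) (auto simp: similar_mat_def)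
  also have "\<dots> = (\<Prod>a\<leftarrow>diag_mat ?D. [:- a, 1:])"
    by (rule char_poly_upper_triangular[of _ d]) (auto simp: mat_diag_def upper_triangular_def)
  also have "diag_mat ?D = map (\<lambda>i. complex_of_real ((\<mu> i)\<^sup>2)) [0..<d]"
    by (auto simp: diag_mat_def mat_diag_def)
  finally have cp: "char_poly (mat_adjoint K * K) =
      (\<Prod>a\<leftarrow>map (\<lambda>i. complex_of_real ((\<mu> i)\<^sup>2)) [0..<d]. [:- a, 1:])" .
  have pr: "proots (\<Prod>a\<leftarrow>xs. [:- a, 1:]) = mset xs" for xs :: "complex list"
  proof (induction xs)
    case (Cons x xs)
    have "(\<Prod>a\<leftarrow>xs. [:- a, 1:]) \<noteq> 0" by (auto simp: prod_list_zero_iff)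
    then show ?case using Cons by (simp add: proots_mult del: mult_pCons_left)
  qed simp
  show ?thesis
    unfolding singular_values_def cp pr
    by (simp add: multiset.map_comp comp_def lessThan_atLeast0 del: of_real_power)
qed

lemma mat_adjoint_smult: "mat_adjoint (c \<cdot>\<^sub>m A) = cnj c \<cdot>\<^sub>m mat_adjoint (A :: complex mat)"
  by (rule eq_matI) auto

lemma commutator_carrier [simp]:
  "A \<in> carrier_mat d d \<Longrightarrow> B \<in> carrier_mat d d \<Longrightarrow> commutator A B \<in> carrier_mat d d"
  unfolding commutator_def by (intro minus_carrier_mat) simp

lemma mat_adjoint_commutator:
  fixes A B :: "complex mat"
  assumes "A \<in> carrier_mat d d" "B \<in> carrier_mat d d" "mat_adjoint A = A" "mat_adjoint B = B"
  shows "mat_adjoint (commutator A B) = - commutator A B"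
proof -
  have adj: "mat_adjoint (A * B) = B * A" "mat_adjoint (B * A) = A * B"
    using assms by (simp_all add: mat_adjoint_mult[of _ d d _ d])
  have e: "cnj ((A * B) $$ (j, i)) = (B * A) $$ (i, j)" "cnj ((B * A) $$ (j, i)) = (A * B) $$ (i, j)"
    if "i < d" "j < d" for i j
    using arg_cong[OF adj(1), of "\<lambda>M. M $$ (i, j)"] arg_cong[OF adj(2), of "\<lambda>M. M $$ (i, j)"] that assms
    by (simp_all del: index_mult_mat(1))
  show ?thesis
    using assms by (intro eq_matI) (auto simp: commutator_def e simp del: index_mult_mat(1))
qed

text \<open>In an eigenbasis of \<open>i[E, F]\<close> every eigenvalue is a diagonal entry of \<open>i[E, F]\<close>, and such an
  entry has modulus at most twice that of the corresponding diagonal entry of \<open>EF\<close>.\<close>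

lemma singular_values_commutator:
  assumes E: "E \<in> carrier_mat d d" "mat_adjoint E = E" and F: "pos_semidef d F"
  obtains \<mu> where "singular_values (commutator E F) = image_mset (\<lambda>i. \<bar>\<mu> i\<bar>) (mset_set {..<d})"
    "(\<Sum>i<d. \<mu> i) = 0"
    "(\<Sum>i<d. \<bar>\<mu> i\<bar>) \<le> 2 * sqrt (Re (mat_trace (E * F * E)) * Re (mat_trace F))"
proof -
  obtain Y where Y: "Y \<in> carrier_mat d d" and FY: "F = Y * mat_adjoint Y"
    using pos_semidef_factor[OF F] .
  have Fc: "F \<in> carrier_mat d d" and Fh: "mat_adjoint F = F"
    using pos_semidef_carrier[OF F] pos_semidef_hermitian[OF F] .
  define K where "K = commutator E F"
  have K: "K \<in> carrier_mat d d" using E Fc by (simp add: K_def)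
  define H where "H = \<i> \<cdot>\<^sub>m K"
  have H: "H \<in> carrier_mat d d" using K by (simp add: H_def)
  have aK: "mat_adjoint K = - K" unfolding K_def by (rule mat_adjoint_commutator[OF E(1) Fc E(2) Fh])
  have Hh: "mat_adjoint H = H" unfolding H_def mat_adjoint_smult aK using K by (intro eq_matI) auto
  from hermitian_diagonalization[OF H Hh] obtain U \<mu> where
    U: "U \<in> carrier_mat d d" and UU: "mat_adjoint U * U = 1\<^sub>m d"
    and HU: "H = U * mat_diag d (\<lambda>i. complex_of_real (\<mu> i)) * mat_adjoint U" by blast
  let ?D = "mat_diag d (\<lambda>i. complex_of_real (\<mu> i))"
  note UU' = unitary_commute[OF U UU]
  note as = assoc_mult_square_mat[where d = d]
  \<comment> \<open>Products are normalised to associate to the left, where a factor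
    \<open>U * mat_adjoint U\<close> in the middle is not a subterm. These equations cancel it in
    context.\<close>
  have ins: "M * U * mat_adjoint U * N = M * N" "M * mat_adjoint U * U * N = M * N"
    if "M \<in> carrier_mat d d" "N \<in> carrier_mat d d" for M N
  proof -
    have "M * U * mat_adjoint U * N = M * (U * mat_adjoint U) * N"
      "M * mat_adjoint U * U * N = M * (mat_adjoint U * U) * N" using U that by (simp_all add: as)
    then show "M * U * mat_adjoint U * N = M * N" "M * mat_adjoint U * U * N = M * N"
      using that by (simp_all add: UU UU' right_mult_one_mat[of _ d d])
  qed
  \<comment> \<open>The commutator is anti-Hermitian and differs from the Hermitian \<open>H\<close>
    by a factor of modulus one, so its singular values are the moduli of the eigenvalues of
    \<open>H\<close>.\<close>
  have "mat_adjoint K * K = H * H"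
  proof -
    have "mat_adjoint K = \<i> \<cdot>\<^sub>m H" "K = (- \<i>) \<cdot>\<^sub>m H"
      unfolding aK H_def using K by (auto intro!: eq_matI)
    then have "mat_adjoint K * K = (\<i> \<cdot>\<^sub>m H) * ((- \<i>) \<cdot>\<^sub>m H)" by simp
    also have "\<dots> = H * H"
      using H mult_smult_assoc_mat[of H d d "(- \<i>) \<cdot>\<^sub>m H" d \<i>] mult_smult_distrib[of H d d H d "- \<i>"]
      by (simp add: smult_smult_assoc) (auto intro!: eq_matI)
    finally show ?thesis .
  qed
  also have "\<dots> = U * (?D * ?D) * mat_adjoint U"
    unfolding HU using U ins(2)[of "U * ?D" "?D * mat_adjoint U"] by (simp add: as del: mat_diag_diag)
  also have "?D * ?D = mat_diag d (\<lambda>i. complex_of_real ((\<mu> i)\<^sup>2))"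
    by (simp add: power2_eq_square)
  finally have sv: "singular_values K = image_mset (\<lambda>i. \<bar>\<mu> i\<bar>) (mset_set {..<d})"
    by (intro singular_values_of_gram_diag[OF U UU K]) auto
  have "complex_of_real (\<Sum>i<d. \<mu> i) = mat_trace ?D"
    by (simp add: mat_trace_def mat_diag_def)
  also have "\<dots> = mat_trace H"
    unfolding HU using U UU by (intro mat_trace_conj[symmetric, of _ d]) auto
  \<comment> \<open>A commutator is traceless because \<open>E * F\<close> and \<open>F * E\<close>
    have the same trace.\<close>
  also have "\<dots> = 0"
    using mat_trace_comm[of E d d F] E Fc K
    by (simp add: H_def mat_trace_smult[where d = d] K_def commutator_def mat_trace_minus[where d = d])
  finally have s0: "(\<Sum>i<d. \<mu> i) = 0" by (simp only: of_real_eq_0_iff)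
  define E' where "E' = mat_adjoint U * E * U"
  define F' where "F' = mat_adjoint U * F * U"
  have E': "E' \<in> carrier_mat d d" "mat_adjoint E' = E'" and F': "F' \<in> carrier_mat d d" "mat_adjoint F' = F'"
    using E Fc Fh U by (auto simp: E'_def F'_def intro!: hermitian_conj)
  \<comment> \<open>In the new basis \<open>F'\<close> keeps a factorization, with
    \<open>mat_adjoint U * Y\<close> in place of \<open>Y\<close>, as the Cauchy-Schwarz estimate
    requires.\<close>
  have F'Y: "F' = (mat_adjoint U * Y) * mat_adjoint (mat_adjoint U * Y)"
    using U Y by (simp add: F'_def FY as mat_adjoint_mult[of _ d d _ d])
  have "?D = mat_adjoint U * H * U"
    unfolding HU by (rule unitary_conj_cancel[OF U UU, symmetric]) simp
  also have "\<dots> = \<i> \<cdot>\<^sub>m (mat_adjoint U * K * U)"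
    unfolding H_def using U K by (simp add: mult_smult_distrib[of _ d d _ d] mult_smult_assoc_mat[of _ d d _ d])
  also have "mat_adjoint U * K * U = commutator E' F'"
  proof -
    have "mat_adjoint U * K * U = mat_adjoint U * (E * F) * U - mat_adjoint U * (F * E) * U"
      unfolding K_def commutator_def using U E Fc
      by (simp add: mult_minus_distrib_mat[of _ d d _ d] minus_mult_distrib_mat[of _ d d _ _ d])
    then show ?thesis
      unfolding commutator_def E'_def F'_def using U E Fc
        ins(1)[of "mat_adjoint U * E" "F * U"] ins(1)[of "mat_adjoint U * F" "E * U"]
      by (simp add: as)
  qed
  finally have D: "?D = \<i> \<cdot>\<^sub>m commutator E' F'" .
  have "\<bar>\<mu> k\<bar> \<le> 2 * cmod ((E' * F') $$ (k, k))" if k: "k < d" for k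
  proof -
    have "F' * E' = mat_adjoint (E' * F')" using E' F' by (simp add: mat_adjoint_mult[of _ d d _ d])
    then have "(F' * E') $$ (k, k) = cnj ((E' * F') $$ (k, k))"
      using E' F' k by (simp del: index_mult_mat(1))
    then have "complex_of_real (\<mu> k) = \<i> * ((E' * F') $$ (k, k) - cnj ((E' * F') $$ (k, k)))"
      using arg_cong[OF D, of "\<lambda>M. M $$ (k, k)"] E' F' k
      by (simp add: commutator_def mat_diag_def del: index_mult_mat(1))
    then have "\<bar>\<mu> k\<bar> = cmod (\<i> * ((E' * F') $$ (k, k) - cnj ((E' * F') $$ (k, k))))"
      by (metis norm_of_real)
    also have "\<dots> \<le> cmod ((E' * F') $$ (k, k)) + cmod (cnj ((E' * F') $$ (k, k)))"
      using norm_triangle_ineq4[of "(E' * F') $$ (k, k)" "cnj ((E' * F') $$ (k, k))"]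
      by (simp add: norm_mult)
    finally show ?thesis by simp
  qed
  then have "(\<Sum>i<d. \<bar>\<mu> i\<bar>) \<le> (\<Sum>i<d. 2 * cmod ((E' * F') $$ (i, i)))" by (intro sum_mono) auto
  also have "\<dots> = 2 * (\<Sum>i<d. cmod ((E' * F') $$ (i, i)))" by (simp add: sum_distrib_left)
  also have "(\<Sum>i<d. cmod ((E' * F') $$ (i, i))) \<le> sqrt (Re (mat_trace (E' * F' * E')) * Re (mat_trace F'))"
    using sum_cmod_diag_mult_le[OF E'(1), of "mat_adjoint U * Y"] U Y by (simp add: F'Y[symmetric] E'(2))
  also have "mat_trace F' = mat_trace F"
    unfolding F'_def by (rule mat_trace_conj) (use Fc U UU' in auto)
  also have "E' * F' * E' = mat_adjoint U * (E * F * E) * U"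
    unfolding E'_def F'_def using U E Fc
        ins(1)[of "mat_adjoint U * E" "F * U"] ins(1)[of "mat_adjoint U * E * F" "E * U"]
    by (simp add: as)
  also have "mat_trace \<dots> = mat_trace (E * F * E)"
    by (rule mat_trace_conj) (use E Fc U UU' in auto)
  finally have "(\<Sum>i<d. \<bar>\<mu> i\<bar>) \<le> 2 * sqrt (Re (mat_trace (E * F * E)) * Re (mat_trace F))" by simp
  with sv s0 that show ?thesis unfolding K_def by blast
qed

subsection \<open>Norm bound and its extremal case\<close>

text \<open>Since the \<open>\<mu> i\<close> add up to zero, the largest \<open>\<bar>\<mu> i\<bar>\<close> is at most half of the sum of all of
  them, so the trace norm bound \<open>2 * S\<close> implies the operator norm bound \<open>S\<close>; interpolation covers
  every other exponent.\<close>

lemma schatten_norm_le_of_trace_norm: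
  fixes d :: nat
  assumes p: "1 \<le> p" and d: "0 < d"
    and sv: "singular_values K = image_mset (\<lambda>i. \<bar>\<mu> i\<bar>) (mset_set {..<d})"
    and s0: "(\<Sum>i<d. \<mu> i) = 0" and s1: "(\<Sum>i<d. \<bar>\<mu> i\<bar>) \<le> 2 * S"
  shows "schatten_norm p K \<le> two_root p * S"
proof -
  have S0: "0 \<le> S" using s1 sum_abs_ge_zero[of \<mu> "{..<d}"] by linarith
  have le: "\<bar>\<mu> k\<bar> \<le> S" if "k < d" for k
  proof -
    have k: "k \<in> {..<d}" using that by simp
    \<comment> \<open>Hence twice \<open>\<bar>\<mu> k\<bar>\<close> is at most the sum of all
      \<open>\<bar>\<mu> i\<bar>\<close>, which is at most \<open>2 * S\<close>.\<close>
    have "\<mu> k = - (\<Sum>i\<in>{..<d} - {k}. \<mu> i)"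
      using s0 sum.remove[OF finite_lessThan k, of \<mu>] by linarith
    then have "\<bar>\<mu> k\<bar> \<le> (\<Sum>i\<in>{..<d} - {k}. \<bar>\<mu> i\<bar>)"
      using sum_abs[of \<mu> "{..<d} - {k}"] by simp
    then show ?thesis using s1 sum.remove[OF finite_lessThan k, of "\<lambda>i. \<bar>\<mu> i\<bar>"] by linarith
  qed
  show ?thesis
  proof (cases "p = \<infinity>")
    case True
    have "Max ((\<lambda>i. \<bar>\<mu> i\<bar>) ` {..<d}) \<le> S"
      using d le by (subst Max_le_iff) auto
    then show ?thesis using True by (simp add: schatten_norm_def sv two_root_def)
  next
    case False
    then obtain q where q: "p = ereal q" "1 \<le> q"
      using p by (cases p) auto
    \<comment> \<open>Interpolation: split one power off each term for the trace norm bound and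
      estimate the remaining \<open>q - 1\<close> powers by \<open>S\<close>.\<close>
    have "(\<Sum>i<d. \<bar>\<mu> i\<bar> powr q) \<le> 2 * S powr q"
    proof -
      have "(\<Sum>i<d. \<bar>\<mu> i\<bar> powr q) \<le> (\<Sum>i<d. \<bar>\<mu> i\<bar> * S powr (q - 1))"
      proof (rule sum_mono)
        fix i assume "i \<in> {..<d}"
        then have "\<bar>\<mu> i\<bar> \<le> S" by (simp add: le)
        then show "\<bar>\<mu> i\<bar> powr q \<le> \<bar>\<mu> i\<bar> * S powr (q - 1)"
        proof (cases "\<mu> i = 0")
          case False
          then have "\<bar>\<mu> i\<bar> powr q = \<bar>\<mu> i\<bar> * \<bar>\<mu> i\<bar> powr (q - 1)"
            using powr_add[of "\<bar>\<mu> i\<bar>" 1 "q - 1"] by simp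
          also have "\<dots> \<le> \<bar>\<mu> i\<bar> * S powr (q - 1)"
            using \<open>\<bar>\<mu> i\<bar> \<le> S\<close> q by (intro mult_left_mono powr_mono2) auto
          finally show ?thesis .
        qed simp
      qed
      also have "\<dots> = (\<Sum>i<d. \<bar>\<mu> i\<bar>) * S powr (q - 1)" by (simp add: sum_distrib_right)
      also have "\<dots> \<le> 2 * S * S powr (q - 1)" using s1 by (intro mult_right_mono) auto
      also have "\<dots> = 2 * S powr q"
        using S0 powr_add[of S 1 "q - 1"] by (cases "S = 0") auto
      finally show ?thesis .
    qed
    then have "(\<Sum>i<d. \<bar>\<mu> i\<bar> powr q) powr (1 / q) \<le> (2 * S powr q) powr (1 / q)"
      using q by (intro powr_mono2) (auto intro!: sum_nonneg)
    also have "\<dots> = 2 powr (1 / q) * S"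
      using q S0 by (simp add: powr_mult powr_powr)
    finally show ?thesis
      using q by (simp add: schatten_norm_def sv two_root_def multiset.map_comp comp_def
          sum_unfold_sum_mset[symmetric])
  qed
qed

text \<open>The commutator does not change if a multiple of the identity is subtracted from \<open>E\<close>;
  the multiple \<open>tr(EF) / tr F\<close> minimises the bound on the trace norm.\<close>

lemma schatten_norm_commutator_le:
  assumes p: "1 \<le> p" and d: "0 < d"
    and E: "E \<in> carrier_mat d d" "mat_adjoint E = E" and F: "pos_semidef d F" "F \<noteq> 0\<^sub>m d d"
  defines "v \<equiv> Re (mat_trace F) * Re (mat_trace (E * E * F)) - (Re (mat_trace (E * F)))\<^sup>2"
  shows "schatten_norm p (commutator E F) \<le> two_root p * sqrt v" "0 \<le> v"
proof -
  have Fc: "F \<in> carrier_mat d d" by (rule pos_semidef_carrier[OF F(1)])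
  have tF: "0 < Re (mat_trace F)" by (rule pos_semidef_trace_pos[OF F])
  define r where "r = Re (mat_trace (E * F)) / Re (mat_trace F)"
  let ?c = "complex_of_real r"
  define G where "G = E - ?c \<cdot>\<^sub>m 1\<^sub>m d"
  have G: "G \<in> carrier_mat d d" using E by (auto simp: G_def intro!: minus_carrier_mat)
  have Gh: "mat_adjoint G = G"
  proof (rule eq_matI)
    fix i j assume "i < dim_row G" "j < dim_col G"
    then have ij: "i < d" "j < d" using G by auto
    have "cnj (E $$ (j, i)) = E $$ (i, j)"
      using arg_cong[OF E(2), of "\<lambda>M. M $$ (i, j)"] E(1) ij by simp
    then show "mat_adjoint G $$ (i, j) = G $$ (i, j)"
      using G E(1) ij by (auto simp: G_def)
  qed (use G in auto)
  have GF: "G * F = E * F - ?c \<cdot>\<^sub>m F"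
    unfolding G_def using E Fc left_mult_one_mat[OF Fc]
    by (simp add: minus_mult_distrib_mat[of _ d d _ _ d] mult_smult_assoc_mat[of _ d d _ d])
  have FG: "F * G = F * E - ?c \<cdot>\<^sub>m F"
    unfolding G_def using E Fc right_mult_one_mat[OF Fc]
    by (simp add: mult_minus_distrib_mat[of _ d d _ d] mult_smult_distrib[of _ d d _ d])
  have com: "commutator G F = commutator E F"
    unfolding commutator_def GF FG using E Fc by (intro eq_matI) auto
  \<comment> \<open>Cyclicity moves one \<open>G\<close> to the front, so that the expansion
    contains \<open>E * E * F\<close> and no \<open>E * F * E\<close>.\<close>
  have "mat_trace (G * F * G) = mat_trace (G * (G * F))"
    using G Fc by (intro mat_trace_comm[of _ d d]) auto
  also have "G * (G * F) = E * (E * F - ?c \<cdot>\<^sub>m F) - ?c \<cdot>\<^sub>m (E * F - ?c \<cdot>\<^sub>m F)"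
    unfolding GF unfolding G_def using E Fc
    by (simp add: minus_mult_distrib_mat[of _ d d _ _ d] mult_smult_assoc_mat[of _ d d _ d]
        left_mult_one_mat[of _ d d] minus_carrier_mat)
  also have "E * (E * F - ?c \<cdot>\<^sub>m F) = E * E * F - ?c \<cdot>\<^sub>m (E * F)"
    using E Fc
    by (simp add: mult_minus_distrib_mat[of _ d d _ d] mult_smult_distrib[of _ d d _ d] assoc_mult_square_mat[where d = d])
  finally have "mat_trace (G * F * G) =
      mat_trace (E * E * F) - ?c * mat_trace (E * F) - ?c * (mat_trace (E * F) - ?c * mat_trace F)"
    using E Fc by (simp add: mat_trace_minus[where d = d] mat_trace_smult[where d = d] minus_carrier_mat)
  then have "Re (mat_trace (G * F * G)) = Re (mat_trace (E * E * F)) - r * Re (mat_trace (E * F))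
      - r * (Re (mat_trace (E * F)) - r * Re (mat_trace F))"
    by simp
  then have "Re (mat_trace (G * F * G)) = Re (mat_trace (E * E * F)) - 2 * r * Re (mat_trace (E * F)) + r\<^sup>2 * Re (mat_trace F)"
    by (simp add: power2_eq_square algebra_simps)
  \<comment> \<open>The trace is a quadratic polynomial in \<open>r\<close>; at the chosen
    \<open>r\<close>, its minimum, multiplication by \<open>tr F\<close> gives exactly
    \<open>v\<close>.\<close>
  then have v: "Re (mat_trace (G * F * G)) * Re (mat_trace F) = v"
    using tF by (simp add: v_def r_def field_simps power2_eq_square)
  from singular_values_commutator[OF G Gh F(1)] obtain \<mu> where
    "singular_values (commutator E F) = image_mset (\<lambda>i. \<bar>\<mu> i\<bar>) (mset_set {..<d})"
    "(\<Sum>i<d. \<mu> i) = 0" and s1: "(\<Sum>i<d. \<bar>\<mu> i\<bar>) \<le> 2 * sqrt v"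
    unfolding v com by blast
  then show "schatten_norm p (commutator E F) \<le> two_root p * sqrt v"
    by (intro schatten_norm_le_of_trace_norm[OF p d]) auto
  \<comment> \<open>The real \<open>sqrt\<close> is an odd function, so a nonnegative value of it
    forces a nonnegative argument.\<close>
  have "0 \<le> sqrt v"
    using s1 sum_abs_ge_zero[of \<mu> "{..<d}"] by linarith
  then show "0 \<le> v" by simp
qed

text \<open>In the proof, \<open>sqrt y \<le> y / (2 * c) + c / 2\<close> is applied with the value
  \<open>c = \<alpha> a * \<phi> b * sqrt (D - 1) / D\<close> that \<open>sqrt y\<close> takes in the extremal case.\<close>

lemma sum_sqrt_variance_extremal:
  fixes \<alpha> \<rho> :: "'a \<Rightarrow> real" and \<phi> :: "'b \<Rightarrow> real" and r t :: "'a \<Rightarrow> 'b \<Rightarrow> real" and D :: real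
  assumes fin: "finite A" "finite B" and D: "1 < D"
    and \<alpha>: "\<And>a. a \<in> A \<Longrightarrow> 0 < \<alpha> a" and \<phi>: "\<And>b. b \<in> B \<Longrightarrow> 0 < \<phi> b"
    and s\<alpha>: "(\<Sum>a\<in>A. \<alpha> a) = D" and s\<phi>: "(\<Sum>b\<in>B. \<phi> b) = D"
    and t: "\<And>a. a \<in> A \<Longrightarrow> (\<Sum>b\<in>B. t a b) = \<alpha> a"
    and r: "\<And>a. a \<in> A \<Longrightarrow> (\<Sum>b\<in>B. r a b) = \<rho> a"
    and \<rho>: "\<And>a. a \<in> A \<Longrightarrow> \<rho> a \<le> (\<alpha> a)\<^sup>2"
    and nn: "\<And>a b. a \<in> A \<Longrightarrow> b \<in> B \<Longrightarrow> 0 \<le> \<phi> b * r a b - (t a b)\<^sup>2"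
    and ge: "D * sqrt (D - 1) \<le> (\<Sum>a\<in>A. \<Sum>b\<in>B. sqrt (\<phi> b * r a b - (t a b)\<^sup>2))"
  shows "\<And>a. a \<in> A \<Longrightarrow> \<rho> a = (\<alpha> a)\<^sup>2"
    and "\<And>a b. a \<in> A \<Longrightarrow> b \<in> B \<Longrightarrow> t a b = \<alpha> a * \<phi> b / D"
proof -
  define s where "s = sqrt (D - 1) / D"
  have s: "0 < s" using D by (simp add: s_def)
  have Ds: "D * s = sqrt (D - 1)" using D by (simp add: s_def)
  have s2: "s * s = (D - 1) / (D * D)" using D by (simp add: s_def)
  \<comment> \<open>The deviation of \<open>t a b\<close> from its extremal value. Below,
    \<open>h a\<close> collects all the slack in the row of \<open>a\<close>: these deviations and
    the gap between \<open>\<rho> a\<close> and \<open>(\<alpha> a)\<^sup>2\<close>.\<close>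
  define \<delta> where "\<delta> a b = (t a b - \<alpha> a * \<phi> b / D)\<^sup>2 / \<phi> b" for a b
  have \<delta>0: "0 \<le> \<delta> a b" if "b \<in> B" for a b using \<phi>[OF that] by (simp add: \<delta>_def)
  define h where "h a = ((\<alpha> a)\<^sup>2 - \<rho> a + (\<Sum>b\<in>B. \<delta> a b)) / (2 * \<alpha> a * s)" for a
  have h0: "0 \<le> h a" if "a \<in> A" for a
    using \<alpha>[OF that] \<rho>[OF that] s \<delta>0 by (simp add: h_def sum_nonneg)
  have amgm: "sqrt y \<le> y / (2 * c) + c / 2" if "0 \<le> y" "0 < c" for y c :: real
  proof -
    have "2 * c * sqrt y \<le> y + c * c"
      using that sum_squares_bound[of c "sqrt y"] by (simp add: power2_eq_square)
    then show ?thesis using that by (simp add: field_simps)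
  qed
  have row: "(\<Sum>b\<in>B. sqrt (\<phi> b * r a b - (t a b)\<^sup>2)) \<le> \<alpha> a * sqrt (D - 1) - h a" if a: "a \<in> A" for a
  proof -
    have "(\<Sum>b\<in>B. sqrt (\<phi> b * r a b - (t a b)\<^sup>2)) \<le>
        (\<Sum>b\<in>B. (r a b - 2 * t a b * \<alpha> a / D + (\<alpha> a)\<^sup>2 * \<phi> b / D\<^sup>2 - \<delta> a b) / (2 * \<alpha> a * s) + \<phi> b * (\<alpha> a * s / 2))"
    proof (rule sum_mono)
      fix b assume b: "b \<in> B"
      have "sqrt (\<phi> b * r a b - (t a b)\<^sup>2) \<le>
          (\<phi> b * r a b - (t a b)\<^sup>2) / (2 * (\<alpha> a * \<phi> b * s)) + \<alpha> a * \<phi> b * s / 2"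
        using \<alpha>[OF a] \<phi>[OF b] s by (intro amgm nn a b) simp
      also have "(\<phi> b * r a b - (t a b)\<^sup>2) / (2 * (\<alpha> a * \<phi> b * s)) =
          ((\<phi> b * r a b - (t a b)\<^sup>2) / \<phi> b) / (2 * \<alpha> a * s)" by simp
      \<comment> \<open>Completing the square in \<open>t a b\<close> leaves terms that can be
        summed over \<open>b\<close> by the normalisations, minus the deviation.\<close>
      also have "(\<phi> b * r a b - (t a b)\<^sup>2) / \<phi> b =
          r a b - 2 * t a b * \<alpha> a / D + (\<alpha> a)\<^sup>2 * \<phi> b / D\<^sup>2 - \<delta> a b"
        using \<phi>[OF b] D by (simp add: \<delta>_def field_simps power2_eq_square)
      finally show "sqrt (\<phi> b * r a b - (t a b)\<^sup>2) \<le>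
          (r a b - 2 * t a b * \<alpha> a / D + (\<alpha> a)\<^sup>2 * \<phi> b / D\<^sup>2 - \<delta> a b) / (2 * \<alpha> a * s) + \<phi> b * (\<alpha> a * s / 2)"
        by (simp add: mult_ac)
    qed
    also have "\<dots> = ((\<Sum>b\<in>B. r a b) - 2 * (\<Sum>b\<in>B. t a b) * \<alpha> a / D + (\<alpha> a)\<^sup>2 * (\<Sum>b\<in>B. \<phi> b) / D\<^sup>2
        - (\<Sum>b\<in>B. \<delta> a b)) / (2 * \<alpha> a * s) + (\<Sum>b\<in>B. \<phi> b) * (\<alpha> a * s / 2)"
      by (simp add: sum.distrib sum_subtractf flip: sum_divide_distrib sum_distrib_left sum_distrib_right)
    also have "\<dots> = (\<rho> a - (\<alpha> a)\<^sup>2 / D - (\<Sum>b\<in>B. \<delta> a b)) / (2 * \<alpha> a * s) + D * (\<alpha> a * s / 2)"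
      unfolding r[OF a] t[OF a] s\<phi> using D by (simp add: field_simps power2_eq_square)
    also have "\<dots> = \<alpha> a * (D * s) - h a"
    proof -
      \<comment> \<open>The choice of \<open>s\<close> makes \<open>D * s * s\<close> equal to
        \<open>1 - 1 / D\<close>, so both halves of the estimate contribute
        \<open>\<alpha> a * D * s / 2\<close>.\<close>
      have e: "(\<alpha> a)\<^sup>2 - (\<alpha> a)\<^sup>2 / D = (\<alpha> a)\<^sup>2 * (D * (s * s))"
        unfolding s2 using D by (simp add: field_simps)
      have "(\<rho> a - (\<alpha> a)\<^sup>2 / D - (\<Sum>b\<in>B. \<delta> a b)) / (2 * \<alpha> a * s) =
          ((\<alpha> a)\<^sup>2 - (\<alpha> a)\<^sup>2 / D) / (2 * \<alpha> a * s) - h a"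
        by (simp add: h_def diff_divide_distrib add_divide_distrib)
      also have "((\<alpha> a)\<^sup>2 - (\<alpha> a)\<^sup>2 / D) / (2 * \<alpha> a * s) = \<alpha> a * D * s / 2"
        unfolding e using \<alpha>[OF a] s by (simp add: field_simps power2_eq_square)
      finally show ?thesis by simp
    qed
    finally show ?thesis unfolding Ds .
  qed
  \<comment> \<open>Summed over the rows, the main terms give exactly the assumed lower bound, so
    nothing is left for the slacks and each \<open>h a\<close> vanishes.\<close>
  have "D * sqrt (D - 1) \<le> (\<Sum>a\<in>A. \<alpha> a * sqrt (D - 1) - h a)"
    by (rule order_trans[OF ge]) (intro sum_mono row)
  also have "\<dots> = D * sqrt (D - 1) - (\<Sum>a\<in>A. h a)"
    by (simp add: sum_subtractf s\<alpha> flip: sum_distrib_right)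
  finally have "(\<Sum>a\<in>A. h a) \<le> 0" by simp
  then have "(\<Sum>a\<in>A. h a) = 0" using h0 by (intro antisym sum_nonneg) auto
  then have h: "h a = 0" if "a \<in> A" for a
    using sum_nonneg_eq_0_iff[of A h] fin(1) h0 that by auto
  have z: "(\<alpha> a)\<^sup>2 - \<rho> a + (\<Sum>b\<in>B. \<delta> a b) = 0" if "a \<in> A" for a
    using h[OF that] \<alpha>[OF that] s by (simp add: h_def)
  have nd: "0 \<le> (\<Sum>b\<in>B. \<delta> a b)" for a using \<delta>0 by (intro sum_nonneg)
  show "\<rho> a = (\<alpha> a)\<^sup>2" if "a \<in> A" for a
    using z[OF that] nd[of a] \<rho>[OF that] by linarith
  show "t a b = \<alpha> a * \<phi> b / D" if a: "a \<in> A" and b: "b \<in> B" for a b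
  proof -
    have "(\<Sum>b\<in>B. \<delta> a b) = 0" using z[OF a] nd[of a] \<rho>[OF a] by linarith
    then have "\<delta> a b = 0" using sum_nonneg_eq_0_iff[of B "\<delta> a"] fin(2) \<delta>0 b by auto
    then show ?thesis using \<phi>[OF b] by (simp add: \<delta>_def)
  qed
qed

subsection \<open>Measurements\<close>

text \<open>With eigenvalues \<open>\<mu> i\<close> and their sum \<open>T\<close>, the difference
  of the two sides is the sum of the terms \<open>\<mu> i * (T - \<mu> i)\<close>, each nonnegative.
  If it vanishes, a positive eigenvalue must equal \<open>T\<close>, so it is the only nonzero
  one.\<close>

lemma mat_trace_pos_semidef_square:
  assumes A: "pos_semidef d A"
  shows "Re (mat_trace (A * A)) \<le> (Re (mat_trace A))\<^sup>2"
    and "A \<noteq> 0\<^sub>m d d \<Longrightarrow> Re (mat_trace (A * A)) = (Re (mat_trace A))\<^sup>2 \<Longrightarrow>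
      \<exists>\<alpha> v. 0 < \<alpha> \<and> v \<in> carrier_vec d \<and> v \<bullet>c v = 1 \<and> A = complex_of_real \<alpha> \<cdot>\<^sub>m ketbra v"
proof -
  from pos_semidef_diagonalization[OF A] obtain U \<mu> where
    U: "U \<in> carrier_mat d d" "mat_adjoint U * U = 1\<^sub>m d"
    and AU: "A = U * mat_diag d (\<lambda>i. complex_of_real (\<mu> i)) * mat_adjoint U"
    and \<mu>: "\<And>i. i < d \<Longrightarrow> 0 \<le> \<mu> i" by blast
  let ?D = "mat_diag d (\<lambda>i. complex_of_real (\<mu> i))"
  have tD: "mat_trace (U * mat_diag d g * mat_adjoint U) = (\<Sum>i<d. g i)" for g
  proof -
    have "mat_trace (U * mat_diag d g * mat_adjoint U) = mat_trace (mat_diag d g)"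
      using U by (intro mat_trace_conj) auto
    then show ?thesis by (simp add: mat_trace_def mat_diag_def)
  qed
  have "A * A = U * (?D * (mat_adjoint U * U) * ?D) * mat_adjoint U"
    unfolding AU using U(1) by (simp add: assoc_mult_square_mat[where d = d] del: mat_diag_diag)
  also have "\<dots> = U * (?D * ?D) * mat_adjoint U"
    unfolding U(2) using right_mult_one_mat[of ?D d d] by simp
  finally have AA: "A * A = U * mat_diag d (\<lambda>i. complex_of_real (\<mu> i * \<mu> i)) * mat_adjoint U"
    by simp
  define T where "T = (\<Sum>i<d. \<mu> i)"
  have tA: "Re (mat_trace A) = T" unfolding AU tD T_def by simp
  have tAA: "(Re (mat_trace A))\<^sup>2 - Re (mat_trace (A * A)) = (\<Sum>i<d. \<mu> i * (T - \<mu> i))"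
    unfolding tA unfolding AA tD
    by (simp add: power2_eq_square right_diff_distrib sum_subtractf T_def sum_distrib_right)
  have le: "\<mu> i \<le> T" if "i < d" for i
    unfolding T_def using that \<mu> by (intro member_le_sum) auto
  have nn: "0 \<le> \<mu> i * (T - \<mu> i)" if "i < d" for i using \<mu>[OF that] le[OF that] by simp
  have "0 \<le> (\<Sum>i<d. \<mu> i * (T - \<mu> i))" using nn by (intro sum_nonneg) simp
  then show "Re (mat_trace (A * A)) \<le> (Re (mat_trace A))\<^sup>2" using tAA by linarith
  assume A0: "A \<noteq> 0\<^sub>m d d" and eq: "Re (mat_trace (A * A)) = (Re (mat_trace A))\<^sup>2"
  have "0 < T" using pos_semidef_trace_pos[OF A A0] tA by simp
  then obtain k where k: "k < d" "0 < \<mu> k"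
    unfolding T_def by (metis lessThan_iff not_less sum_nonpos)
  have "(\<Sum>i<d. \<mu> i * (T - \<mu> i)) = 0" using tAA eq by simp
  then have "\<mu> k * (T - \<mu> k) = 0"
    using sum_nonneg_eq_0_iff[of "{..<d}" "\<lambda>i. \<mu> i * (T - \<mu> i)"] nn k by blast
  then have "T = \<mu> k" using k by simp
  then have "(\<Sum>i\<in>{..<d} - {k}. \<mu> i) = 0"
    unfolding T_def using k sum.remove[of "{..<d}" k \<mu>] by simp
  then have z: "\<mu> i = 0" if "i < d" "i \<noteq> k" for i
    using sum_nonneg_eq_0_iff[of "{..<d} - {k}" \<mu>] \<mu> that by auto
  define v where "v = col U k"
  have v: "v \<in> carrier_vec d" using U(1) by (auto simp: v_def intro: carrier_vecI)
  have "v \<bullet>c v = (\<Sum>i<d. U $$ (i, k) * cnj (U $$ (i, k)))"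
    using U(1) k by (simp add: v_def scalar_prod_def lessThan_atLeast0)
  also have "\<dots> = (\<Sum>i<d. mat_adjoint U $$ (k, i) * U $$ (i, k))"
    using U(1) k by (intro sum.cong) auto
  also have "\<dots> = (mat_adjoint U * U) $$ (k, k)"
    using U(1) k by (intro index_mult_mat_sum[symmetric, where n = d and k = d]) auto
  finally have "v \<bullet>c v = 1" unfolding U(2) using k by simp
  moreover have "A = complex_of_real (\<mu> k) \<cdot>\<^sub>m ketbra v"
  proof (rule eq_matI)
    fix i j assume "i < dim_row (complex_of_real (\<mu> k) \<cdot>\<^sub>m ketbra v)"
      "j < dim_col (complex_of_real (\<mu> k) \<cdot>\<^sub>m ketbra v)"
    then have ij: "i < d" "j < d" using v by (auto simp: ketbra_def)
    \<comment> \<open>All summands of the spectral decomposition except that of \<open>k\<close>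
      vanish.\<close>
    have "A $$ (i, j) = (\<Sum>l<d. (U * ?D) $$ (i, l) * mat_adjoint U $$ (l, j))"
      unfolding AU using U(1) ij by (intro index_mult_mat_sum) auto
    also have "\<dots> = (\<Sum>l<d. if l = k then U $$ (i, k) * complex_of_real (\<mu> k) * cnj (U $$ (j, k)) else 0)"
      using U(1) ij z by (intro sum.cong) (auto simp: mat_diag_mult_right[OF U(1)])
    also have "\<dots> = U $$ (i, k) * complex_of_real (\<mu> k) * cnj (U $$ (j, k))" using k by simp
    finally show "A $$ (i, j) = (complex_of_real (\<mu> k) \<cdot>\<^sub>m ketbra v) $$ (i, j)"
      using ij U(1) k by (simp add: ketbra_def v_def)
  qed (use pos_semidef_carrier[OF A] v in \<open>auto simp: ketbra_def\<close>)
  ultimately show "\<exists>\<alpha> v. 0 < \<alpha> \<and> v \<in> carrier_vec d \<and> v \<bullet>c v = 1 \<and> A = complex_of_real \<alpha> \<cdot>\<^sub>m ketbra v"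
    using v k by blast
qed

section \<open>Rank-one operators\<close>

lemma ketbra_carrier [simp]: "v \<in> carrier_vec d \<Longrightarrow> ketbra v \<in> carrier_mat d d"
  by (auto simp: ketbra_def)

lemma mat_trace_ketbra: "v \<in> carrier_vec d \<Longrightarrow> mat_trace (ketbra v) = v \<bullet>c v"
  by (simp add: mat_trace_def ketbra_def scalar_prod_def lessThan_atLeast0)

lemma mat_trace_ketbra_mult:
  assumes "v \<in> carrier_vec d" "w \<in> carrier_vec d"
  shows "mat_trace (ketbra v * ketbra w) = complex_of_real ((cmod (w \<bullet>c v))\<^sup>2)"
proof -
  have "mat_trace (ketbra v * ketbra w) =
      (\<Sum>i<d. \<Sum>j<d. v $ i * cnj (v $ j) * (w $ j * cnj (w $ i)))"
    using assms by (subst mat_trace_mult[of _ d d]) (auto simp: ketbra_def intro!: sum.cong)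
  also have "\<dots> = (\<Sum>j<d. w $ j * cnj (v $ j)) * cnj (\<Sum>i<d. w $ i * cnj (v $ i))"
    by (simp add: sum_product mult_ac)
  also have "(\<Sum>j<d. w $ j * cnj (v $ j)) = w \<bullet>c v"
    using assms by (simp add: scalar_prod_def lessThan_atLeast0)
  finally show ?thesis by (simp add: complex_norm_square del: of_real_power)
qed

text \<open>The entries are products of a row factor and a column factor, so the rank is at most
  one; the column at an index where \<open>v\<close> does not vanish is nonzero, so the rank is at
  least one.\<close>

lemma rank_smult_ketbra:
  assumes v: "v \<in> carrier_vec d" "v \<bullet>c v = 1" and \<alpha>: "\<alpha> \<noteq> 0"
  shows "vec_space.rank d (\<alpha> \<cdot>\<^sub>m ketbra v) = 1"
proof -
  interpret vec_space "TYPE(complex)" d .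
  let ?A = "\<alpha> \<cdot>\<^sub>m ketbra v"
  have A: "?A \<in> carrier_mat d d" using v by simp
  have "rank ?A \<le> 1"
    by (rule rank_le_1_product_entries[OF A, of "\<lambda>i. \<alpha> * v $ i" "\<lambda>j. cnj (v $ j)"])
       (use v in \<open>auto simp: ketbra_def\<close>)
  moreover have "1 \<le> rank ?A"
  proof -
    have "\<exists>i<d. v $ i \<noteq> 0"
    proof (rule ccontr)
      assume "\<not> (\<exists>i<d. v $ i \<noteq> 0)"
      then have "v \<bullet>c v = 0" using v(1) by (simp add: scalar_prod_def)
      then show False using v by simp
    qed
    then obtain i where i: "i < d" "v $ i \<noteq> 0" by blast
    define c where "c = col ?A i"
    have c: "c \<in> carrier_vec d" using v by (auto simp: c_def ketbra_def intro: carrier_vecI)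
    have ci: "c $ i \<noteq> 0" using i v \<alpha> by (simp add: c_def ketbra_def)
    have "lin_indpt {c}"
    proof
      let ?M = "mat_of_cols d [c]"
      have cols: "cols ?M = [c]" and M: "?M \<in> carrier_mat d 1" using c by (auto intro: carrier_matI)
      assume "lin_dep {c}"
      then obtain w where w: "w \<in> carrier_vec 1" "w \<noteq> 0\<^sub>v 1" "?M *\<^sub>v w = 0\<^sub>v d"
        using lin_depE[OF M] by (auto simp: cols)
      have "c $ i * w $ 0 = (?M *\<^sub>v w) $ i"
        using w(1) i c by (simp add: scalar_prod_def mat_of_cols_index)
      then have "w $ 0 = 0" using w(3) i ci by simp
      then have "w = 0\<^sub>v 1" using w(1) by (intro eq_vecI) auto
      with w(2) show False by simp
    qed
    moreover have "{c} \<subseteq> set (cols ?A)" using i v by (auto simp: cols_def c_def ketbra_def)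
    ultimately show ?thesis using rank_ge_card_indpt[OF A, of "{c}"] by simp
  qed
  ultimately show ?thesis by simp
qed

text \<open>Swapping the arguments changes the sign of the commutator, and the sign cancels in the
  product with the adjoint that defines the singular values.\<close>

lemma schatten_norm_commutator_swap:
  assumes "A \<in> carrier_mat d d" "B \<in> carrier_mat d d"
  shows "schatten_norm p (commutator A B) = schatten_norm p (commutator B A)"
proof -
  let ?K = "commutator A B"
  have K: "?K \<in> carrier_mat d d" using assms by simp
  have s: "commutator B A = - ?K"
    unfolding commutator_def using assms by (intro eq_matI) auto
  have "mat_adjoint (- ?K) = - mat_adjoint ?K" using K by (intro eq_matI) auto
  then have "mat_adjoint (- ?K) * (- ?K) = mat_adjoint ?K * ?K"
    using K uminus_mult_left_mat[of "mat_adjoint ?K" "- ?K"] uminus_mult_right_mat[of "mat_adjoint ?K" ?K]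
    by (auto intro!: eq_matI)
  then have "singular_values (commutator B A) = singular_values ?K"
    unfolding s singular_values_def by simp
  then show ?thesis by (simp add: schatten_norm_def)
qed

section \<open>Sums over outcomes and the extremal case\<close>

lemma measurementD:
  assumes "measurement d n E"
  shows "a \<in> {1..n} \<Longrightarrow> pos_semidef d (E a)" "a \<in> {1..n} \<Longrightarrow> E a \<noteq> 0\<^sub>m d d"
    "a \<in> {1..n} \<Longrightarrow> E a \<in> carrier_mat d d" "a \<in> {1..n} \<Longrightarrow> mat_adjoint (E a) = E a"
  using assms unfolding measurement_def by (auto intro: pos_semidef_hermitian pos_semidef_carrier)

text \<open>By linearity the sum over the outcomes turns into the identity. A general
  \<open>X\<close> is allowed because the identity, \<open>E a\<close> and \<open>E a * E a\<close>
  are all inserted later.\<close>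

lemma measurement_sum_trace:
  assumes E: "measurement d n E" and X: "X \<in> carrier_mat d d"
  shows "(\<Sum>a=1..n. mat_trace (X * E a)) = mat_trace X"
proof -
  have s: "(\<Sum>a=1..n. E a $$ (j, i)) = (if j = i then 1 else 0)" if "i < d" "j < d" for i j
    using arg_cong[of _ _ "\<lambda>M. M $$ (j, i)", OF conjunct2[OF E[unfolded measurement_def]]] that by simp
  have "(\<Sum>a=1..n. mat_trace (X * E a)) = (\<Sum>a=1..n. \<Sum>i<d. \<Sum>j<d. X $$ (i, j) * E a $$ (j, i))"
    by (intro sum.cong refl mat_trace_mult[OF X] measurementD[OF E])
  also have "\<dots> = (\<Sum>i<d. \<Sum>j<d. X $$ (i, j) * (\<Sum>a=1..n. E a $$ (j, i)))"
    by (subst sum.swap, rule sum.cong[OF refl], subst sum.swap) (simp add: sum_distrib_left)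
  also have "\<dots> = (\<Sum>i<d. \<Sum>j<d. if j = i then X $$ (i, i) else 0)"
    by (intro sum.cong refl) (simp add: s del: One_nat_def)
  also have "\<dots> = mat_trace X" using X by (simp add: mat_trace_def)
  finally show ?thesis .
qed

lemma measurement_sum_trace_one:
  assumes E: "measurement d n E"
  shows "(\<Sum>a=1..n. mat_trace (E a)) = of_nat d"
proof -
  have "(\<Sum>a=1..n. mat_trace (E a)) = (\<Sum>a=1..n. mat_trace (1\<^sub>m d * E a))"
    using measurementD(3)[OF E] by (intro sum.cong) (auto simp: left_mult_one_mat[of _ d d])
  also have "\<dots> = mat_trace (1\<^sub>m d)" by (rule measurement_sum_trace[OF E]) simp
  finally show ?thesis by (simp add: mat_trace_def)
qed

text \<open>Bounding each summand by the commutator estimate and cancelling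
  \<open>two_root p\<close> turns the hypothesis into the lower bound of
  \<open>sum_sqrt_variance_extremal\<close>, whose equality conditions are the two claims.\<close>

lemma Upsilon_extremal:
  assumes p: "1 \<le> p" and E: "measurement d nE E" and F: "measurement d nF F"
    and U: "Upsilon p nE E nF F = two_root p * real d * sqrt (real d - 1)"
    and a: "a \<in> {1..nE}"
  shows "Re (mat_trace (E a * E a)) = (Re (mat_trace (E a)))\<^sup>2"
    and "b \<in> {1..nF} \<Longrightarrow> Re (mat_trace (E a * F b)) = Re (mat_trace (E a)) * Re (mat_trace (F b)) / real d"
proof -
  note mE = measurementD[OF E] and mF = measurementD[OF F]
  \<comment> \<open>The general argument divides by \<open>sqrt (d - 1)\<close>, so it starts at
    dimension two. In dimension zero there is no nonzero operator, and in dimension one all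
    operators are real scalars.\<close>
  consider "d = 0" | "d = 1" | "2 \<le> d" by linarith
  then have "Re (mat_trace (E a * E a)) = (Re (mat_trace (E a)))\<^sup>2 \<and>
    (b \<in> {1..nF} \<longrightarrow> Re (mat_trace (E a * F b)) = Re (mat_trace (E a)) * Re (mat_trace (F b)) / real d)"
  proof cases
    case 1
    then show ?thesis using mE(2,3)[OF a] by (auto intro: eq_matI)
  next
    case 2
    have tr: "Re (mat_trace (A * B)) = Re (mat_trace A) * Re (mat_trace B)"
      if "A \<in> carrier_mat d d" "B \<in> carrier_mat d d" "mat_adjoint A = A" for A B
    proof -
      have "cnj (A $$ (0, 0)) = A $$ (0, 0)"
        using arg_cong[OF that(3), of "\<lambda>M. M $$ (0, 0)"] that(1) 2 by simp
      then have "Im (A $$ (0, 0)) = 0" by (simp add: complex_eq_iff)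
      then show ?thesis
        unfolding mat_trace_mult[OF that(1,2)] using that(1,2) 2 by (simp add: mat_trace_def)
    qed
    show ?thesis
      using tr[OF mE(3)[OF a] mE(3)[OF a] mE(4)[OF a]] tr[OF mE(3)[OF a] mF(3) mE(4)[OF a]] 2
      by (auto simp: power2_eq_square)
  next
    case 3
    define v where "v a b = Re (mat_trace (F b)) * Re (mat_trace (E a * E a * F b)) - (Re (mat_trace (E a * F b)))\<^sup>2" for a b
    have bound: "schatten_norm p (commutator (E a) (F b)) \<le> two_root p * sqrt (v a b)" and v0: "0 \<le> v a b"
      if "a \<in> {1..nE}" "b \<in> {1..nF}" for a b
      using schatten_norm_commutator_le[OF p _ mE(3)[OF that(1)] mE(4)[OF that(1)] mF(1)[OF that(2)] mF(2)[OF that(2)]] 3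
      by (simp_all add: v_def)
    have tp: "0 < two_root p" by (simp add: two_root_def)
    have "two_root p * (real d * sqrt (real d - 1)) \<le> (\<Sum>a=1..nE. \<Sum>b=1..nF. two_root p * sqrt (v a b))"
      unfolding mult.assoc[symmetric] U[symmetric] Upsilon_def by (intro sum_mono bound)
    also have "\<dots> = two_root p * (\<Sum>a=1..nE. \<Sum>b=1..nF. sqrt (v a b))"
      by (simp add: sum_distrib_left)
    finally have ge: "real d * sqrt (real d - 1) \<le> (\<Sum>a=1..nE. \<Sum>b=1..nF. sqrt (v a b))"
      using tp by simp
    have s1: "(\<Sum>a=1..nE. Re (mat_trace (E a))) = real d" "(\<Sum>b=1..nF. Re (mat_trace (F b))) = real d"
      using measurement_sum_trace_one[OF E] measurement_sum_trace_one[OF F] by (simp_all flip: Re_sum)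
    have s2: "(\<Sum>b=1..nF. Re (mat_trace (X * F b))) = Re (mat_trace X)" if "X \<in> carrier_mat d d" for X
      using measurement_sum_trace[OF F that] by (simp flip: Re_sum)
    have D: "1 < real d" using 3 by simp
    \<comment> \<open>The roles of \<alpha>, \<phi>, t, r and \<rho> are played by the traces of
      \<open>E a\<close>, \<open>F b\<close>, \<open>E a * F b\<close>,
      \<open>E a * E a * F b\<close> and \<open>E a * E a\<close>. The fact \<open>s2\<close> enters
      with \<open>E a\<close> and with \<open>E a * E a\<close>.\<close>
    note ext = sum_sqrt_variance_extremal[of "{1..nE}" "{1..nF}" "real d" "\<lambda>a. Re (mat_trace (E a))"
        "\<lambda>b. Re (mat_trace (F b))" "\<lambda>a b. Re (mat_trace (E a * F b))"
        "\<lambda>a b. Re (mat_trace (E a * E a * F b))" "\<lambda>a. Re (mat_trace (E a * E a))",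
        folded v_def, OF _ _ D _ _ s1 s2 s2 _ v0 ge]
    show ?thesis
      using ext a pos_semidef_trace_pos[OF mE(1,2)] pos_semidef_trace_pos[OF mF(1,2)] mE(3)
        mat_trace_pos_semidef_square(1)[OF mE(1)] by auto
  qed
  then show "Re (mat_trace (E a * E a)) = (Re (mat_trace (E a)))\<^sup>2"
    and "b \<in> {1..nF} \<Longrightarrow> Re (mat_trace (E a * F b)) = Re (mat_trace (E a)) * Re (mat_trace (F b)) / real d"
    by blast+
qed

text \<open>The rank-one conclusion is drawn for the first measurement only; this symmetry carries
  it over to the second.\<close>

lemma Upsilon_swap:
  assumes E: "measurement d nE E" and F: "measurement d nF F"
  shows "Upsilon p nE E nF F = Upsilon p nF F nE E"
  unfolding Upsilon_def
  by (subst sum.swap)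
     (intro sum.cong refl schatten_norm_commutator_swap[of _ d] measurementD(3)[OF E] measurementD(3)[OF F])

lemma Upsilon_extremal_rank_one:
  assumes p: "1 \<le> p" and E: "measurement d nE E" and F: "measurement d nF F"
    and U: "Upsilon p nE E nF F = two_root p * real d * sqrt (real d - 1)"
  shows "\<exists>\<alpha> e. rank_one_form d nE E \<alpha> e"
proof -
  have "\<forall>a\<in>{1..nE}. \<exists>x v. 0 < x \<and> v \<in> carrier_vec d \<and> v \<bullet>c v = 1 \<and> E a = complex_of_real x \<cdot>\<^sub>m ketbra v"
  proof
    fix a assume a: "a \<in> {1..nE}"
    show "\<exists>x v. 0 < x \<and> v \<in> carrier_vec d \<and> v \<bullet>c v = 1 \<and> E a = complex_of_real x \<cdot>\<^sub>m ketbra v"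
      by (rule mat_trace_pos_semidef_square(2)[OF measurementD(1)[OF E a] measurementD(2)[OF E a]])
         (rule Upsilon_extremal(1)[OF p E F U a])
  qed
  then show ?thesis unfolding rank_one_form_def by metis
qed

lemma rank_one_form_rank:
  assumes "rank_one_form d n E \<alpha> e" "a \<in> {1..n}"
  shows "vec_space.rank d (E a) = 1"
proof -
  have "0 < \<alpha> a" "e a \<in> carrier_vec d" "e a \<bullet>c e a = 1" "E a = complex_of_real (\<alpha> a) \<cdot>\<^sub>m ketbra (e a)"
    using assms by (auto simp: rank_one_form_def)
  then show ?thesis using rank_smult_ketbra[of "e a" d "complex_of_real (\<alpha> a)"] by simp
qed

theorem corollary3:
  fixes d nE nF :: nat and p :: ereal and E F :: "nat \<Rightarrow> complex mat"
  assumes "1 \<le> p"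
    and "measurement d nE E"
    and "measurement d nF F"
    and "Upsilon p nE E nF F = two_root p * real d * sqrt (real d - 1)"
  shows "(\<forall>a \<in> {1..nE}. vec_space.rank d (E a) = 1) \<and>
    (\<forall>b \<in> {1..nF}. vec_space.rank d (F b) = 1) \<and>
    (\<exists>\<alpha> e \<beta> f. rank_one_form d nE E \<alpha> e \<and> rank_one_form d nF F \<beta> f) \<and>
    (\<forall>\<alpha> e \<beta> f. rank_one_form d nE E \<alpha> e \<and> rank_one_form d nF F \<beta> f \<longrightarrow>
      (\<forall>a \<in> {1..nE}. \<forall>b \<in> {1..nF}. cmod (f b \<bullet>c e a) = 1 / sqrt (real d)))"
proof -
  note U' = assms(4)[unfolded Upsilon_swap[OF assms(2,3)]]
  from Upsilon_extremal_rank_one[OF assms] obtain \<alpha> e where e: "rank_one_form d nE E \<alpha> e" by blast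
  from Upsilon_extremal_rank_one[OF assms(1,3,2) U'] obtain \<beta> f where f: "rank_one_form d nF F \<beta> f" by blast
  \<comment> \<open>The overlaps are computed for arbitrary rank-one decompositions, since phases of
    the vectors may differ from those just obtained.\<close>
  have "cmod (f b \<bullet>c e a) = 1 / sqrt (real d)"
    if "rank_one_form d nE E \<alpha> e" "rank_one_form d nF F \<beta> f" and a: "a \<in> {1..nE}" and b: "b \<in> {1..nF}"
    for \<alpha> e \<beta> f a b
  proof -
    have ea: "0 < \<alpha> a" "e a \<in> carrier_vec d" "e a \<bullet>c e a = 1" "E a = complex_of_real (\<alpha> a) \<cdot>\<^sub>m ketbra (e a)"
      and fb: "0 < \<beta> b" "f b \<in> carrier_vec d" "f b \<bullet>c f b = 1" "F b = complex_of_real (\<beta> b) \<cdot>\<^sub>m ketbra (f b)"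
      using that by (auto simp: rank_one_form_def)
    have tr: "mat_trace (E a) = complex_of_real (\<alpha> a)" "mat_trace (F b) = complex_of_real (\<beta> b)"
      using ea fb by (simp_all add: mat_trace_smult[where d = d] mat_trace_ketbra[where d = d])
    have "E a * F b = (complex_of_real (\<alpha> a) * complex_of_real (\<beta> b)) \<cdot>\<^sub>m (ketbra (e a) * ketbra (f b))"
      unfolding ea(4) fb(4) using ea(2) fb(2)
      by (simp add: mult_smult_assoc_mat[of _ d d _ d] mult_smult_distrib[of _ d d _ d] smult_smult_assoc)
        (auto intro!: eq_matI)
    then have "mat_trace (E a * F b) = complex_of_real (\<alpha> a * \<beta> b * (cmod (f b \<bullet>c e a))\<^sup>2)"
      using ea(2) fb(2) by (simp add: mat_trace_smult[where d = d] mat_trace_ketbra_mult[where d = d])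
    \<comment> \<open>Two evaluations of \<open>tr (E a * F b)\<close> are compared: one from the
      vectors, one from extremality, where the traces of the factors are \<open>\<alpha> a\<close>
      and \<open>\<beta> b\<close>.\<close>
    then have "\<alpha> a * \<beta> b * (cmod (f b \<bullet>c e a))\<^sup>2 = \<alpha> a * \<beta> b / real d"
      using Upsilon_extremal(2)[OF assms a b] tr by simp
    then have "(cmod (f b \<bullet>c e a))\<^sup>2 = 1 / real d" 
      using ea(1) fb(1) mult_left_cancel[of "\<alpha> a * \<beta> b" "(cmod (f b \<bullet>c e a))\<^sup>2" "1 / real d"] by simp
    then show ?thesis by (metis norm_ge_zero real_sqrt_divide real_sqrt_one real_sqrt_unique)
  qed
  then show ?thesis
    using e f rank_one_form_rank[OF e] rank_one_form_rank[OF f] by blast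
qed

end
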